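(* Let $m$ be a positive integer and let $h(z)\in\mathbb{C}[z]$ be a polynomial which is not of the form $h_1(z^l)$ for any polynomial $h_1$ and any integer $l>1$. Let $S:L^2_a(D)\to L^2_a(D)$ be a bounded linear operator which commutes with the Toeplitz operator $T_{h(z^m)}$. Then $S$ commutes with $T_{z^m}$, i.e. $[S,T_{z^m}]=0$. In particular, if in addition $S$ is compact, then $S=0$.
   Context: $D=\{z\in\mathbb{C}:|z|<1\}$ is the open unit disk with normalized Lebesgue area measure $dA$ (so $D$ has measure $1$). $L^2_a(D)$ is the Bergman space of square-integrable holomorphic functions on $D$, a closed subspace of $L^2(D)$ with inner product $\langle f,g\rangle=\int_D f\bar g\,dA$; $P$ denotes the orthogonal projection of $L^2(D)$ onto $L^2_a(D)$. For $f\in L^\infty(D)$, the Toeplitz operator $T_f:L^2_a(D)\to L^2_a(D)$ is $T_f(g)=P(fg)$. $[A,B]=AB-BA$. *)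

theory Defs
  imports "HOL-Complex_Analysis.Complex_Analysis" "HOL-Computational_Algebra.Polynomial"
begin

text \<open>Functions on the unit disk D are represented as functions complex => complex
  that vanish outside D (so that elements of the Bergman space are determined uniquely).
  Normalized area measure dA = (Lebesgue measure on D) / pi.\<close>

definition disk :: "complex set" where "disk = ball 0 1"

definition L2D :: "(complex \<Rightarrow> complex) set" where
  "L2D = {f. set_borel_measurable lborel disk f \<and>
             set_integrable lborel disk (\<lambda>z. (cmod (f z))\<^sup>2)}"

definition bergman :: "(complex \<Rightarrow> complex) set" where
  "bergman = {f. f \<in> L2D \<and> f holomorphic_on disk \<and> (\<forall>z. z \<notin> disk \<longrightarrow> f z = 0)}"

definition l2_inner :: "(complex \<Rightarrow> complex) \<Rightarrow> (complex \<Rightarrow> complex) \<Rightarrow> complex" where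
  "l2_inner f g = (LINT z:disk|lborel. f z * cnj (g z)) / complex_of_real pi"

definition l2_norm :: "(complex \<Rightarrow> complex) \<Rightarrow> real" where
  "l2_norm f = sqrt ((LINT z:disk|lborel. (cmod (f z))\<^sup>2) / pi)"

definition bergman_proj :: "(complex \<Rightarrow> complex) \<Rightarrow> (complex \<Rightarrow> complex)" where
  "bergman_proj f = (THE g. g \<in> bergman \<and> (\<forall>k\<in>bergman. l2_inner (\<lambda>z. f z - g z) k = 0))"

definition toeplitz :: "(complex \<Rightarrow> complex) \<Rightarrow> (complex \<Rightarrow> complex) \<Rightarrow> (complex \<Rightarrow> complex)" where
  "toeplitz \<phi> g = bergman_proj (\<lambda>z. \<phi> z * g z)"

definition bounded_op :: "((complex \<Rightarrow> complex) \<Rightarrow> (complex \<Rightarrow> complex)) \<Rightarrow> bool" where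
  "bounded_op S \<longleftrightarrow>
     (\<forall>f\<in>bergman. S f \<in> bergman) \<and>
     (\<forall>f\<in>bergman. \<forall>g\<in>bergman. S (\<lambda>z. f z + g z) = (\<lambda>z. S f z + S g z)) \<and>
     (\<forall>f\<in>bergman. \<forall>c. S (\<lambda>z. c * f z) = (\<lambda>z. c * S f z)) \<and>
     (\<exists>C. \<forall>f\<in>bergman. l2_norm (S f) \<le> C * l2_norm f)"

definition compact_op :: "((complex \<Rightarrow> complex) \<Rightarrow> (complex \<Rightarrow> complex)) \<Rightarrow> bool" where
  "compact_op S \<longleftrightarrow>
     (\<forall>F::nat \<Rightarrow> complex \<Rightarrow> complex. (\<forall>n. F n \<in> bergman) \<and> (\<exists>B::real. \<forall>n. l2_norm (F n) \<le> B) \<longrightarrow>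
        (\<exists>(r::nat\<Rightarrow>nat) g. strict_mono r \<and> g \<in> bergman \<and>
              (\<lambda>n. l2_norm (\<lambda>z. S (F (r n)) z - g z)) \<longlonglongrightarrow> 0))"

definition commutes_on_bergman ::
  "((complex \<Rightarrow> complex) \<Rightarrow> (complex \<Rightarrow> complex)) \<Rightarrow> ((complex \<Rightarrow> complex) \<Rightarrow> (complex \<Rightarrow> complex)) \<Rightarrow> bool" where
  "commutes_on_bergman A B \<longleftrightarrow> (\<forall>f\<in>bergman. A (B f) = B (A f))"

end

theory Submission
  imports Defs "HOL-Computational_Algebra.Fundamental_Theorem_Algebra"
begin

text \<open>
  If v is a point of the open disk such that \<open>h(u) - h(v) = (u - v) q(u)\<close> with q free of zeros on the closed
  disk, then for \<open>w\<^sup>m = v\<close> every function \<open>(z\<^sup>m - w\<^sup>m) f\<close> is a multiple of \<open>h(z\<^sup>m) - h(w\<^sup>m)\<close> in the Bergman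
  space. Hence \<open>S((z\<^sup>m - w\<^sup>m) f)\<close> vanishes at w, i.e. \<open>S(z\<^sup>m f)(w) = w\<^sup>m (S f)(w)\<close>, and if such v
  fill an open set the identity theorem finishes the first part.

  Such v exist near a point of the unit circle T whose value under h is attained only once, and simply, on the
  closed disk. The set of v in T with a second partner u in T (or with \<open>h'(v) = 0\<close>) is finite: writing u = t v
  and conjugating gives a second polynomial equation, elimination of v leaves finitely many t, and for each t
  finitely many v because h is not a polynomial in \<open>z\<^sup>l\<close>. Since the boundary of \<open>h(D)\<close> is infinite, some
  remaining v in T has \<open>h(v)\<close> outside \<open>h(D)\<close>.

  For compact S and bounded f, apply S to \<open>z\<^bsup>mn\<^esup> f\<close>, normalised by the norm of \<open>z\<^bsup>mn\<^esup>\<close>: the image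
  is \<open>z\<^bsup>mn\<^esup> S f\<close>, equally normalised. It tends to 0 pointwise, yet rotation invariance of area and Cauchy's
  formula bound its norm below unless S f = 0. For arbitrary f, write f as a Taylor polynomial plus
  \<open>z\<^bsup>mk\<^esup> g\<close>; then S f is divisible by \<open>z\<^bsup>mk\<^esup>\<close> for all k.
\<close>

section \<open>Self-intersections of the image of the unit circle\<close>

text \<open>Convention: a \<open>complex poly poly\<close> is a polynomial in v over C[t]. Inserting
  the constant polynomial \<open>[:v:]\<close> and then t gives the value at (t, v); the two
  evaluations may be swapped.\<close>

lemma poly_poly_const: "poly (poly p [:v:]) t = poly (map_poly (\<lambda>c. poly c t) p) (v::complex)"
  by (induction p) (auto simp: map_poly_pCons)

lemma bivariate_elimination:
  fixes p q :: "complex poly poly"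
  assumes "p \<noteq> 0"
    and inf: "infinite {t. \<forall>v. \<not> (poly (poly p [:v:]) t = 0 \<and> poly (poly q [:v:]) t = 0)}"
  shows "\<exists>R. R \<noteq> 0 \<and> (\<forall>t v. poly (poly p [:v:]) t = 0 \<longrightarrow> poly (poly q [:v:]) t = 0 \<longrightarrow> poly R t = 0)"
proof -
  \<comment> \<open>An element g of minimal degree in the ideal divides p and q up to a factor in \<open>\<complex>[t]\<close>, so if g
    had positive degree its roots would be common roots of p and q for almost all t.\<close>
  define I where "I = {A * p + B * q | A B. True}"
  have Iz: "poly (poly g [:v:]) t = 0"
    if "g \<in> I" "poly (poly p [:v:]) t = 0" "poly (poly q [:v:]) t = 0" for g t v
    using that by (auto simp: I_def)
  have pI: "p \<in> I" unfolding I_def by (intro CollectI exI[of _ 1] exI[of _ 0]) simp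
  have qI: "q \<in> I" unfolding I_def by (intro CollectI exI[of _ 0] exI[of _ 1]) simp
  define g where "g = arg_min degree (\<lambda>g. g \<in> I \<and> g \<noteq> 0)"
  have g: "g \<in> I" "g \<noteq> 0"
    using arg_min_natI[of "\<lambda>g. g \<in> I \<and> g \<noteq> 0" p degree] pI assms(1) by (auto simp: g_def)
  have gmin: "degree g \<le> degree f" if "f \<in> I" "f \<noteq> 0" for f
    unfolding g_def using arg_min_nat_le[of "\<lambda>g. g \<in> I \<and> g \<noteq> 0" f degree] that by auto
  define c where "c = lead_coeff g"
  have c0: "c \<noteq> 0" using g by (simp add: c_def)
  have div: "\<exists>k s. smult (c ^ k) f = g * s" if f: "f \<in> I" for f
  proof -
    obtain s r where sr: "pseudo_divmod f g = (s, r)" by force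
    from pseudo_divmod[OF g(2) sr]
    have 1: "smult (c ^ (Suc (degree f) - degree g)) f = g * s + r" and 2: "r = 0 \<or> degree r < degree g"
      by (auto simp: c_def)
    obtain A B where AB: "f = A * p + B * q" using f by (auto simp: I_def)
    obtain A' B' where AB': "g = A' * p + B' * q" using g by (auto simp: I_def)
    have "r = [:c ^ (Suc (degree f) - degree g):] * f - g * s" using 1 by simp
    also have "\<dots> = ([:c ^ (Suc (degree f) - degree g):] * A - A' * s) * p
                   + ([:c ^ (Suc (degree f) - degree g):] * B - B' * s) * q"
      unfolding AB AB' by (simp only: ring_distribs mult.assoc add.assoc) (simp add: mult_ac algebra_simps)
    finally have "r \<in> I" by (auto simp: I_def)
    with 2 gmin have "r = 0" by fastforce
    with 1 show ?thesis by auto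
  qed
  show ?thesis
  proof (cases "degree g = 0")
    case True
    \<comment> \<open>A combination of p and q that is free of v is already the eliminant.\<close>
    then obtain R where R: "g = [:R:]" by (meson degree_eq_zeroE)
    with g Iz[OF g(1)] show ?thesis by (intro exI[of _ R]) auto
  next
    case False
    have "{t. \<forall>v. \<not> (poly (poly p [:v:]) t = 0 \<and> poly (poly q [:v:]) t = 0)} \<subseteq> {t. poly c t = 0}"
    proof (rule subsetI, rule ccontr)
      fix t assume *: "t \<in> {t. \<forall>v. \<not> (poly (poly p [:v:]) t = 0 \<and> poly (poly q [:v:]) t = 0)}"
        "t \<notin> {t. poly c t = 0}"
      hence t: "\<forall>v. \<not> (poly (poly p [:v:]) t = 0 \<and> poly (poly q [:v:]) t = 0)" "poly c t \<noteq> 0" by auto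
      define gt where "gt = map_poly (\<lambda>c. poly c t) g"
      \<comment> \<open>As c does not vanish at t, specialising t preserves the degree of g, so
        \<open>gt\<close> is nonconstant and has a root v.\<close>
      have "coeff gt (degree g) \<noteq> 0" using t by (simp add: gt_def coeff_map_poly c_def)
      hence "degree gt > 0" using False le_degree[of gt "degree g"] by auto
      then obtain v where v: "poly gt v = 0"
        using fundamental_theorem_of_algebra[of gt] by (auto simp: constant_degree)
      have "poly (poly f [:v:]) t = 0" if f: "f \<in> I" for f
      proof -
        obtain k s where ks: "smult (c ^ k) f = g * s" using div[OF f] by blast
        have "poly (poly (smult (c ^ k) f) [:v:]) t = 0"
          unfolding ks using v by (simp add: poly_poly_const[of g] gt_def)
        thus ?thesis using t(2) by simp
      qed
      with t pI qI show False by blast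
    qed
    with inf c0 poly_roots_finite[of c] show ?thesis by (meson finite_subset)
  qed
qed

section \<open>Difference quotients of polynomials that are not polynomials in a power of z\<close>

text \<open>The quotient (h(u) - h(v)) / (u - v) as a polynomial in u and v. On the diagonal it is
  h'(v), so its nonvanishing for all u says both that v is the only point with value h(v) and that
  this value is simple.\<close>

definition divdiff :: "complex poly \<Rightarrow> complex \<Rightarrow> complex \<Rightarrow> complex" where
  "divdiff h u v = (\<Sum>j\<le>degree h. coeff h j * (\<Sum>i<j. u ^ i * v ^ (j - Suc i)))"

lemma divdiff: "(u - v) * divdiff h u v = poly h u - poly h v"
proof -
  have "poly h u - poly h v = (\<Sum>j\<le>degree h. coeff h j * (u ^ j - v ^ j))"
    by (simp add: poly_altdef sum_subtractf algebra_simps)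
  also have "\<dots> = (\<Sum>j\<le>degree h. (u - v) * (coeff h j * (\<Sum>i<j. u ^ i * v ^ (j - Suc i))))"
  proof (intro sum.cong refl)
    fix j
    have "u ^ j - v ^ j = (u - v) * (\<Sum>i<j. u ^ i * v ^ (j - Suc i))"
      by (subst power_diff_sumr2) (simp add: mult.commute)
    thus "coeff h j * (u ^ j - v ^ j) = (u - v) * (coeff h j * (\<Sum>i<j. u ^ i * v ^ (j - Suc i)))"
      by simp
  qed
  finally show ?thesis by (simp add: divdiff_def sum_distrib_left)
qed

lemma pcompose_monom_if_coeff_dvd:
  fixes h :: "complex poly"
  assumes "\<And>j. coeff h j \<noteq> 0 \<Longrightarrow> l dvd j"
  shows "\<exists>h1. h = pcompose h1 (monom 1 l)"
proof
  show "h = pcompose (\<Sum>j\<le>degree h. monom (coeff h j) (j div l)) (monom 1 l)"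
  proof (subst poly_eq_poly_eq_iff[symmetric], rule ext)
    fix z
    have "poly h z = (\<Sum>j\<le>degree h. coeff h j * (z ^ l) ^ (j div l))"
      unfolding poly_altdef
    proof (intro sum.cong refl)
      fix j show "coeff h j * z ^ j = coeff h j * (z ^ l) ^ (j div l)"
        using assms[of j] by (cases "coeff h j = 0") (auto simp flip: power_mult)
    qed
    thus "poly h z = poly (pcompose (\<Sum>j\<le>degree h. monom (coeff h j) (j div l)) (monom 1 l)) z"
      by (simp add: poly_pcompose poly_sum poly_monom)
  qed
qed

locale primitive_poly =
  fixes h :: "complex poly"
  assumes prim: "\<not> (\<exists>h1 (l::nat). l > 1 \<and> h = pcompose h1 (monom 1 l))"
begin

abbreviation "n \<equiv> degree h"
abbreviation "a \<equiv> coeff h"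

text \<open>A constant is a polynomial in z^2, hence excluded by \<open>prim\<close>.\<close>

lemma degree_pos: "n > 0"
proof (rule ccontr)
  assume "\<not> n > 0"
  hence "a j \<noteq> 0 \<Longrightarrow> 2 dvd j" for j using le_degree[of h j] by auto
  from pcompose_monom_if_coeff_dvd[of h 2, OF this] show False using prim by force
qed

text \<open>The q-analogue of j: with u = t v one has u^j - v^j = (t - 1) \<open>qnum t j\<close>
  v^j, and at t = 1 the value is j.\<close>

definition qnum :: "complex \<Rightarrow> nat \<Rightarrow> complex" where "qnum t j = (\<Sum>i<j. t ^ i)"

text \<open>If all these products vanished for some t other than 1, then t would be a root of unity
  whose order l > 1 divides every exponent occurring in h, making h a polynomial in z^l. At t = 1
  the leading term n a_n survives.\<close>

lemma qnum_coeff_nonzero: "\<exists>j. a j * qnum t j \<noteq> 0"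
proof (rule ccontr)
  assume *: "\<nexists>j. a j * qnum t j \<noteq> 0"
  have an: "a n \<noteq> 0" using degree_pos by auto
  show False
  proof (cases "t = 1")
    case True
    with * an have "(of_nat n :: complex) = 0" by (auto simp: qnum_def dest: spec[of _ n])
    thus False using degree_pos by simp
  next
    case t: False
    have pw: "t ^ j = 1" if "a j \<noteq> 0" for j
    proof -
      have "(\<Sum>i<j. t ^ i) = 0" using * that by (auto simp: qnum_def)
      thus ?thesis using power_diff_1_eq[of t j] by simp
    qed
    define l where "l = (LEAST l. l > 0 \<and> t ^ l = 1)"
    have l: "l > 0 \<and> t ^ l = 1" unfolding l_def
      by (rule LeastI[of _ n]) (use pw an degree_pos in auto)
    have lmin: "\<not> (k > 0 \<and> t ^ k = 1)" if "k < l" for k using not_less_Least that unfolding l_def by blast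
    have "l \<noteq> 1" using l t by auto
    have "l dvd j" if aj: "a j \<noteq> 0" for j
    proof -
      have "t ^ j = (t ^ l) ^ (j div l) * t ^ (j mod l)"
        by (simp flip: power_mult power_add)
      hence "t ^ (j mod l) = 1" using pw[OF aj] l by simp
      moreover have "j mod l < l" using l by simp
      ultimately show ?thesis using lmin[of "j mod l"] by auto
    qed
    hence "\<exists>h1. h = pcompose h1 (monom 1 l)" by (rule pcompose_monom_if_coeff_dvd)
    moreover have "l > 1" using l \<open>l \<noteq> 1\<close> by auto
    ultimately show False using prim by blast
  qed
qed

text \<open>Substituting u = t v, the function v * divdiff h (t v) v becomes the polynomial P in (t, v),
  written as a polynomial in v over \<open>\<complex>[t]\<close>. On |t| = |v| = 1 its complex conjugate is, up to a
  monomial factor, again a polynomial; this is P'. At t = 0, P' is the nonzero constant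
  cnj (lead_coeff h) while P keeps its full degree in v, so the two have no common factor.\<close>

definition P :: "complex poly poly" where
  "P = (\<Sum>j\<le>n. monom (smult (a j) (\<Sum>i<j. monom 1 i)) j)"

definition P' :: "complex poly poly" where
  "P' = (\<Sum>j\<le>n. monom (smult (cnj (a j)) ((\<Sum>i<j. monom 1 i) * monom 1 (n - j))) (n - j))"

lemma eval_P: "poly (poly P [:v:]) t = (\<Sum>j\<le>n. a j * qnum t j * v ^ j)"
  by (simp add: P_def poly_sum poly_monom qnum_def poly_power mult_ac)

lemma eval_P': "poly (poly P' [:v:]) t = (\<Sum>j\<le>n. cnj (a j) * qnum t j * (t * v) ^ (n - j))"
  by (simp add: P'_def poly_sum poly_monom qnum_def poly_power power_mult_distrib mult_ac)

lemma eval_P_divdiff: "poly (poly P [:v:]) t = v * divdiff h (t * v) v"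
proof -
  have "a j * qnum t j * v ^ j = v * (a j * (\<Sum>i<j. (t * v) ^ i * v ^ (j - Suc i)))" for j
  proof -
    have "t ^ i * v ^ j = v * ((t * v) ^ i * v ^ (j - Suc i))" if "i < j" for i
    proof -
      have "v ^ j = v * v ^ i * v ^ (j - Suc i)" using that by (simp flip: power_Suc power_add)
      thus ?thesis by (simp add: power_mult_distrib)
    qed
    hence "qnum t j * v ^ j = v * (\<Sum>i<j. (t * v) ^ i * v ^ (j - Suc i))"
      by (simp add: qnum_def sum_distrib_left sum_distrib_right)
    thus ?thesis by (simp add: algebra_simps)
  qed
  thus ?thesis by (simp add: eval_P divdiff_def sum_distrib_left)
qed

lemma eval_P'_zero:
  assumes "cmod t = 1" "cmod v = 1" "poly (poly P [:v:]) t = 0"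
  shows "poly (poly P' [:v:]) t = 0"
proof -
  have t: "t \<noteq> 0" "v \<noteq> 0" using assms by auto
  have ct: "cnj t = inverse t" "cnj v = inverse v"
    using assms complex_norm_square[of t] complex_norm_square[of v] t
    by (auto simp: field_simps)
  \<comment> \<open>On the unit circle conjugation is inversion; this monomial clears all negative
    powers.\<close>
  have "0 = t ^ (n - 1) * v ^ n * cnj (poly (poly P [:v:]) t)" using assms by simp
  also have "\<dots> = (\<Sum>j\<le>n. t ^ (n - 1) * v ^ n * (cnj (a j) * (\<Sum>i<j. inverse t ^ i) * inverse v ^ j))"
    by (simp add: eval_P qnum_def ct sum_distrib_left)
  also have "\<dots> = (\<Sum>j\<le>n. cnj (a j) * qnum t j * (t * v) ^ (n - j))"
  proof (intro sum.cong refl)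
    fix j assume j: "j \<in> {..n}"
    have v: "v ^ n * inverse v ^ j = v ^ (n - j)"
      using j t by (simp add: power_diff power_inverse field_simps)
    \<comment> \<open>Inverting t in \<open>qnum t j\<close> only reverses the order of the
      summands, up to the factor t^(1-j).\<close>
    have "t ^ (n - 1) * (\<Sum>i<j. inverse t ^ i) = (\<Sum>i<j. t ^ i * t ^ (n - j))"
      unfolding sum_distrib_left
    proof (rule sum.reindex_bij_witness[of _ "\<lambda>i. j - 1 - i" "\<lambda>i. j - 1 - i"], auto)
      fix i assume i: "i < j"
      hence "t ^ (n - 1) = t ^ (j - Suc i) * t ^ (n - j) * t ^ i" using j
        by (simp flip: power_add)
      thus "t ^ (j - Suc i) * t ^ (n - j) = t ^ (n - Suc 0) * inverse t ^ i"
        using t by (simp add: power_inverse)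
    qed
    hence tt: "t ^ (n - 1) * (\<Sum>i<j. inverse t ^ i) = qnum t j * t ^ (n - j)"
      by (simp add: qnum_def sum_distrib_right)
    have "t ^ (n - 1) * v ^ n * (cnj (a j) * (\<Sum>i<j. inverse t ^ i) * inverse v ^ j)
      = cnj (a j) * (t ^ (n - 1) * (\<Sum>i<j. inverse t ^ i)) * (v ^ n * inverse v ^ j)"
      by (simp only: mult_ac)
    thus "t ^ (n - 1) * v ^ n * (cnj (a j) * (\<Sum>i<j. inverse t ^ i) * inverse v ^ j)
        = cnj (a j) * qnum t j * (t * v) ^ (n - j)"
      unfolding v tt by (simp add: power_mult_distrib mult_ac)
  qed
  finally show ?thesis by (simp add: eval_P')
qed


definition Pt :: "complex \<Rightarrow> complex poly" where
  "Pt t = (\<Sum>j\<le>n. monom (a j * qnum t j) j)"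

lemma poly_Pt: "poly (Pt t) v = poly (poly P [:v:]) t"
  by (simp add: Pt_def eval_P poly_sum poly_monom)

text \<open>Ensures that each fixed ratio t = u / v occurs for only finitely many v.\<close>

lemma Pt_nonzero: "Pt t \<noteq> 0"
proof -
  obtain j where j: "a j * qnum t j \<noteq> 0" using qnum_coeff_nonzero by blast
  hence "j \<le> n" by (auto intro: le_degree)
  hence "coeff (Pt t) j = a j * qnum t j"
    by (simp add: Pt_def coeff_sum)
  with j show ?thesis by auto
qed

lemma P_nonzero: "P \<noteq> 0"
proof
  assume "P = 0"
  hence "poly (Pt 0) v = 0" for v by (simp add: poly_Pt)
  thus False using Pt_nonzero[of 0] poly_all_0_iff_0 by blast
qed

lemma norm_qnum_le: 
  assumes "cmod t \<le> 1" "j \<le> n" shows "cmod (qnum t j) \<le> n"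
proof -
  have "cmod (qnum t j) \<le> (\<Sum>i<j. cmod (t ^ i))" unfolding qnum_def by (rule norm_sum)
  also have "\<dots> \<le> (\<Sum>i<j. 1)" by (intro sum_mono) (use assms in \<open>auto simp: norm_power power_le_one\<close>)
  finally show ?thesis using assms by simp
qed

text \<open>For small t the leading coefficient of P in v stays away from 0, so every root v is
  bounded by some B. Then t v is small, and the term j = n of P' dominates all others, so P' cannot
  vanish there.\<close>

lemma no_common_root_near_0:
  "\<exists>\<delta>>0. \<forall>t v. cmod t < \<delta> \<longrightarrow> poly (poly P [:v:]) t = 0 \<longrightarrow> poly (poly P' [:v:]) t \<noteq> 0"
proof -
  define A where "A = (\<Sum>j\<le>n. cmod (a j))"
  have an: "cmod (a n) > 0" using degree_pos by auto
  have A: "A \<ge> cmod (a n)" unfolding A_def by (rule member_le_sum) auto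
  \<comment> \<open>A Cauchy root bound: the lower coefficients sum to at most n A, the leading one
    is at least |a_n| / 2.\<close>
  define B where "B = 2 * n * A / cmod (a n)"
  have B2n: "B \<ge> 2 * n"
    using mult_left_mono[OF A, of "2 * n"] an unfolding B_def by (simp add: field_simps)
  hence B1: "B \<ge> 1" using degree_pos by linarith
  have sumlt: "(\<Sum>j<n. cmod (a j)) \<le> A" unfolding A_def by (intro sum_mono2) auto
  show ?thesis
  \<comment> \<open>For this radius |t| B^2 < 1, which is exactly what the final comparison in P'
    contradicts.\<close>
  proof (intro exI[of _ "1 / B\<^sup>2"] conjI allI impI notI)
    show "1 / B\<^sup>2 > 0" using B1 by simp
    fix t v
    assume t: "cmod t < 1 / B\<^sup>2" and 1: "poly (poly P [:v:]) t = 0" and 2: "poly (poly P' [:v:]) t = 0"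
    have tB2: "cmod t * B * B < 1" using t B1 by (simp add: field_simps power2_eq_square)
    have tB: "cmod t * B \<le> 1"
    proof -
      have "cmod t * B * 1 \<le> cmod t * B * B" using B1 by (intro mult_left_mono) auto
      thus ?thesis using tB2 by linarith
    qed
    have t1: "cmod t \<le> 1"
    proof -
      have "cmod t * 1 \<le> cmod t * B" using B1 by (intro mult_left_mono) auto
      thus ?thesis using tB by linarith
    qed
    have tn: "cmod t * (2 * n) \<le> 1"
      using mult_left_mono[OF B2n, of "cmod t"] tB by simp
    obtain n' where n': "n = Suc n'" using degree_pos by (cases n) auto
    have q: "cmod (qnum t n) \<ge> 1 / 2"
    proof -
      have "qnum t n = 1 + t * qnum t n'"
        unfolding qnum_def n' sum.lessThan_Suc_shift by (simp add: sum_distrib_left)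
      hence "cmod (qnum t n) \<ge> 1 - cmod (t * qnum t n')"
        by (metis norm_diff_ineq norm_one)
      moreover have "cmod (t * qnum t n') \<le> cmod t * n"
        unfolding norm_mult by (intro mult_left_mono norm_qnum_le t1) (auto simp: n')
      ultimately show ?thesis using tn by simp
    qed
    have vB: "cmod v \<le> B"
    proof (rule ccontr)
      assume "\<not> cmod v \<le> B"
      hence v: "cmod v > B" "cmod v > 1" using B1 by auto
      have "a n * qnum t n * v ^ n = - (\<Sum>j<n. a j * qnum t j * v ^ j)"
        using 1 unfolding eval_P by (simp add: lessThan_Suc_atMost[symmetric] add_eq_0_iff)
      from arg_cong[OF this, of cmod]
      have "cmod (a n) * cmod (qnum t n) * cmod v ^ n = cmod (\<Sum>j<n. a j * qnum t j * v ^ j)"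
        by (simp only: norm_minus_cancel norm_mult norm_power)
      also have "\<dots> \<le> (\<Sum>j<n. cmod (a j * qnum t j * v ^ j))" by (rule norm_sum)
      also have "\<dots> \<le> (\<Sum>j<n. cmod (a j) * n * cmod v ^ n')"
        unfolding norm_mult norm_power
      proof (intro sum_mono mult_mono norm_qnum_le power_increasing t1)
        fix j assume "j \<in> {..<n}"
        thus "j \<le> n'" "j \<le> n" by (simp_all add: n')
        show "1 \<le> cmod v" using v by linarith
      qed simp_all
      also have "\<dots> = (\<Sum>j<n. cmod (a j)) * n * cmod v ^ n'" by (simp add: sum_distrib_right)
      also have "\<dots> \<le> A * n * cmod v ^ n'" by (intro mult_right_mono sumlt) auto
      finally have "(cmod (a n) * cmod (qnum t n) * cmod v) * cmod v ^ n' \<le> (A * n) * cmod v ^ n'"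
        by (simp add: n' mult_ac)
      hence 3: "cmod (a n) * cmod (qnum t n) * cmod v \<le> A * n"
        by (rule mult_right_le_imp_le) (rule zero_less_power, use v in linarith)
      have "cmod (a n) * (1/2) * cmod v \<le> cmod (a n) * cmod (qnum t n) * cmod v"
        by (intro mult_right_mono mult_left_mono q) auto
      with 3 have "cmod (a n) * cmod v \<le> 2 * n * A" by (simp add: mult_ac)
      hence "cmod v \<le> B" using an unfolding B_def by (simp add: field_simps)
      thus False using v by simp
    qed
    have tv: "cmod (t * v) \<le> cmod t * B" unfolding norm_mult by (intro mult_left_mono vB) auto
    have "cnj (a n) * qnum t n = - (\<Sum>j<n. cnj (a j) * qnum t j * (t * v) ^ (n - j))"
      using 2 unfolding eval_P' by (simp add: lessThan_Suc_atMost[symmetric] add_eq_0_iff)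
    from arg_cong[OF this, of cmod]
    have "cmod (a n) * cmod (qnum t n) = cmod (\<Sum>j<n. cnj (a j) * qnum t j * (t * v) ^ (n - j))"
      by (simp only: norm_minus_cancel norm_mult complex_mod_cnj)
    also have "\<dots> \<le> (\<Sum>j<n. cmod (cnj (a j) * qnum t j * (t * v) ^ (n - j)))" by (rule norm_sum)
    also have "\<dots> \<le> (\<Sum>j<n. cmod (a j) * n * (cmod t * B))"
      unfolding norm_mult[of "_ * _" "_ ^ _"] norm_mult[of _ "qnum _ _"] norm_power complex_mod_cnj
    proof (intro sum_mono mult_mono norm_qnum_le)
      fix j assume j: "j \<in> {..<n}"
      have "cmod (t * v) ^ (n - j) \<le> cmod (t * v) ^ 1"
        using j tv tB by (intro power_decreasing) auto
      thus "cmod (t * v) ^ (n - j) \<le> cmod t * B" using tv by simp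
    qed (use t1 B1 in auto)
    also have "\<dots> = (\<Sum>j<n. cmod (a j)) * n * (cmod t * B)" by (simp add: sum_distrib_right)
    also have "\<dots> \<le> A * n * (cmod t * B)" using B1 by (intro mult_right_mono sumlt) auto
    finally have "cmod (a n) * (1/2) \<le> A * n * (cmod t * B)"
      using mult_left_mono[OF q, of "cmod (a n)"] by simp
    hence "cmod (a n) \<le> (2 * n * A) * (cmod t * B)" by (simp add: mult_ac)
    hence "1 \<le> B * (cmod t * B)" using an unfolding B_def by (simp add: field_simps)
    with tB2 show False by (simp add: mult_ac)
  qed
qed

lemma finite_self_intersections:
  "finite {v. cmod v = 1 \<and> (\<exists>u. cmod u = 1 \<and> divdiff h u v = 0)}"
proof -
  obtain \<delta> where \<delta>: "\<delta> > 0"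
    "\<And>t v. cmod t < \<delta> \<Longrightarrow> poly (poly P [:v:]) t = 0 \<Longrightarrow> poly (poly P' [:v:]) t \<noteq> 0"
    using no_common_root_near_0 by blast
  \<comment> \<open>Self-intersections have |t| = 1, but elimination needs only infinitely many t
    without a common root, wherever they lie.\<close>
  have "ball 0 \<delta> \<subseteq> {t. \<forall>v. \<not> (poly (poly P [:v:]) t = 0 \<and> poly (poly P' [:v:]) t = 0)}"
    using \<delta> by auto
  moreover have "infinite (ball (0::complex) \<delta>)"
    using uncountable_ball[OF \<delta>(1)] uncountable_infinite by blast
  ultimately have "infinite {t. \<forall>v. \<not> (poly (poly P [:v:]) t = 0 \<and> poly (poly P' [:v:]) t = 0)}"
    using finite_subset by blast
  from bivariate_elimination[OF P_nonzero this] obtain R where R: "R \<noteq> 0"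
    "\<And>t v. poly (poly P [:v:]) t = 0 \<Longrightarrow> poly (poly P' [:v:]) t = 0 \<Longrightarrow> poly R t = 0" by blast
  have "{v. cmod v = 1 \<and> (\<exists>u. cmod u = 1 \<and> divdiff h u v = 0)} \<subseteq>
      (\<Union>t\<in>{t. poly R t = 0}. {v. poly (Pt t) v = 0})"
  proof clarify
    fix u v assume *: "cmod v = 1" "cmod u = 1" "divdiff h u v = 0"
    define t where "t = u / v"
    have v: "v \<noteq> 0" using * by auto
    have 1: "poly (poly P [:v:]) t = 0" using * v by (simp add: eval_P_divdiff t_def)
    have "cmod t = 1" using * by (simp add: t_def norm_divide)
    from eval_P'_zero[OF this *(1) 1] R 1 have "poly R t = 0" by blast
    thus "v \<in> (\<Union>t\<in>{t. poly R t = 0}. {v. poly (Pt t) v = 0})" using 1 by (auto simp: poly_Pt)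
  qed
  moreover have "finite (\<Union>t\<in>{t. poly R t = 0}. {v. poly (Pt t) v = 0})"
    using R Pt_nonzero by (intro finite_UN_I poly_roots_finite) auto
  ultimately show ?thesis using finite_subset by blast
qed
end

section \<open>Boundary values of h that are attained once and simply\<close>

text \<open>A finite set does not disconnect the plane. The complement of a finite frontier would be
  connected and meet S, hence lie in S, and the whole plane would be bounded.\<close>

lemma infinite_frontier_bounded_open:
  fixes S :: "complex set"
  assumes "open S" "bounded S" "S \<noteq> {}"
  shows "infinite (frontier S)"
proof
  assume fin: "finite (frontier S)"
  have "connected (- frontier S)"
    by (intro path_connected_imp_connected path_connected_complement_countable)
       (use fin in \<open>auto intro: countable_finite\<close>)
  moreover have "- frontier S \<inter> S \<noteq> {}"
    using assms by (auto simp: frontier_def interior_open)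
  ultimately have "- frontier S - S = {}"
    using connected_Int_frontier[of "- frontier S" S] by blast
  hence "UNIV = frontier S \<union> S" by auto
  moreover have "bounded (frontier S \<union> S)" using fin assms by (simp add: finite_imp_bounded)
  ultimately show False using not_bounded_UNIV by metis
qed

lemma continuous_on_divdiff: "continuous_on A (\<lambda>x. divdiff h (fst x) (snd x))"
  unfolding divdiff_def by (intro continuous_intros)

lemma (in primitive_poly) exists_simple_boundary_value:
  "\<exists>v. cmod v = 1 \<and> (\<forall>u\<in>cball 0 1. divdiff h u v \<noteq> 0)"
proof -
  \<comment> \<open>The boundary of \<open>h(D)\<close> is infinite and is not met by \<open>h(D)\<close> itself.\<close>
  define bad where "bad = {v. cmod v = 1 \<and> (\<exists>u. cmod u = 1 \<and> divdiff h u v = 0)}"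
  define \<Omega> where "\<Omega> = poly h ` ball 0 1"
  have nc: "\<not> poly h constant_on ball 0 1"
  proof
    assume "poly h constant_on ball 0 1"
    then obtain c where c: "\<And>z. z \<in> ball 0 1 \<Longrightarrow> poly h z = c" by (auto simp: constant_on_def)
    have "ball (0::complex) 1 \<subseteq> {z. poly (h - [:c:]) z = 0}" using c by auto
    moreover have "h - [:c:] \<noteq> 0" using degree_pos by (metis degree_pCons_0 eq_iff_diff_eq_0 less_irrefl)
    ultimately have "finite (ball (0::complex) 1)" using poly_roots_finite finite_subset by blast
    thus False using uncountable_ball[of 1 "0::complex"] uncountable_infinite by auto
  qed
  have op: "open \<Omega>" unfolding \<Omega>_def
    by (rule open_mapping_thm[of "poly h" "ball 0 1"]) (use nc in \<open>auto intro!: holomorphic_intros\<close>)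
  have comp: "compact (poly h ` cball 0 1)"
    by (intro compact_continuous_image continuous_intros) auto
  have cl: "closure \<Omega> \<subseteq> poly h ` cball 0 1"
    unfolding \<Omega>_def by (rule closure_minimal) (use compact_imp_closed[OF comp] in auto)
  have "bounded \<Omega>" using bounded_subset[OF compact_imp_bounded[OF comp]] cl closure_subset by blast
  hence "infinite (frontier \<Omega>)"
    by (intro infinite_frontier_bounded_open op) (auto simp: \<Omega>_def)
  moreover have "finite (poly h ` bad)" using finite_self_intersections by (simp add: bad_def)
  ultimately obtain y where y: "y \<in> frontier \<Omega>" "y \<notin> poly h ` bad" by (meson finite_subset subsetI)
  then obtain v where v: "v \<in> cball 0 1" "y = poly h v" using cl by (auto simp: frontier_def)
  have y\<Omega>: "y \<notin> \<Omega>" using y op by (simp add: frontier_def interior_open)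
  hence v1: "cmod v = 1" using v by (force simp: \<Omega>_def)
  \<comment> \<open>A zero u inside the open disk would put y into the image, and one on the circle
    would make v bad.\<close>
  have "divdiff h u v \<noteq> 0" if u: "u \<in> cball 0 1" for u
  proof
    assume 0: "divdiff h u v = 0"
    hence "poly h u = poly h v" using divdiff[of u v h] by simp
    hence "u \<notin> ball 0 1" using y\<Omega> v by (metis \<Omega>_def imageI)
    hence "cmod u = 1" using u by auto
    with 0 v1 have "v \<in> bad" by (auto simp: bad_def)
    with y v show False by blast
  qed
  with v1 show ?thesis by blast
qed

text \<open>Since u ranges over a compact set, the exceptional v form a closed set; the good point
  on the circle therefore has good neighbours inside the disk.\<close>

lemma (in primitive_poly) exists_open_simple_values:
  "\<exists>V. open V \<and> V \<noteq> {} \<and> V \<subseteq> ball 0 1 \<and> (\<forall>v\<in>V. \<forall>u\<in>cball 0 1. divdiff h u v \<noteq> 0)"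
proof -
  obtain v0 where v0: "cmod v0 = 1" "\<And>u. u \<in> cball 0 1 \<Longrightarrow> divdiff h u v0 \<noteq> 0"
    using exists_simple_boundary_value by blast
  define Z where "Z = {v. \<exists>u. u \<in> cball 0 1 \<and> (u, v) \<in> {x. divdiff h (fst x) (snd x) = 0}}"
  have "closed Z" unfolding Z_def
    by (intro closed_compact_projection closed_Collect_eq continuous_on_divdiff) auto
  hence "open (- Z)" by auto
  moreover have "v0 \<in> - Z" using v0 by (auto simp: Z_def)
  moreover have "v0 \<in> closure (ball 0 1)" using v0 by simp
  ultimately have "- Z \<inter> ball 0 1 \<noteq> {}" by (meson closure_iff_nhds_not_empty disjoint_iff order_refl)
  thus ?thesis using \<open>open (- Z)\<close>
    by (intro exI[of _ "- Z \<inter> ball 0 1"]) (auto simp: Z_def)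
qed

section \<open>The Bergman space and operators commuting with multiplications\<close>

lemma open_disk [simp]: "open disk" and connected_disk [simp]: "connected disk"
  and disk_borel [measurable]: "disk \<in> sets borel"
  by (auto simp: disk_def)

lemma in_disk_iff: "z \<in> disk \<longleftrightarrow> cmod z < 1" by (simp add: disk_def)

lemma borel_measurable_holomorphic_on_disk:
  assumes "f holomorphic_on disk" "\<And>z. z \<notin> disk \<Longrightarrow> f z = 0"
  shows "f \<in> borel_measurable borel"
proof -
  have "(\<lambda>z. indicator disk z *\<^sub>R f z) \<in> borel_measurable borel"
    by (rule borel_measurable_continuous_on_indicator)
       (auto intro: holomorphic_on_imp_continuous_on assms)
  also have "(\<lambda>z. indicator disk z *\<^sub>R f z) = f" using assms(2) by (auto simp: indicator_def)
  finally show ?thesis .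
qed

text \<open>Elements vanish off the disk, so integrals over the disk become integrals over the
  plane.\<close>

lemma bergman_iff:
  "f \<in> bergman \<longleftrightarrow> f holomorphic_on disk \<and> (\<forall>z. z \<notin> disk \<longrightarrow> f z = 0) \<and> integrable lborel (\<lambda>z. (cmod (f z))\<^sup>2)"
proof (cases "f holomorphic_on disk \<and> (\<forall>z. z \<notin> disk \<longrightarrow> f z = 0)")
  case True
  hence [measurable]: "f \<in> borel_measurable borel" by (intro borel_measurable_holomorphic_on_disk) auto
  have "(\<lambda>z. indicator disk z *\<^sub>R (cmod (f z))\<^sup>2) = (\<lambda>z. (cmod (f z))\<^sup>2)"
    using True by (auto simp: indicator_def fun_eq_iff)
  thus ?thesis using True
    by (auto simp: bergman_def L2D_def set_integrable_def set_borel_measurable_def)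
qed (auto simp: bergman_def)

lemma bergmanD:
  assumes "f \<in> bergman"
  shows "f holomorphic_on disk" "z \<notin> disk \<Longrightarrow> f z = 0" "integrable lborel (\<lambda>z. (cmod (f z))\<^sup>2)"
    "f \<in> borel_measurable borel"
  using assms borel_measurable_holomorphic_on_disk[of f] by (auto simp: bergman_iff)

lemma bergman_dominated:
  assumes "f holomorphic_on disk" "\<And>z. z \<notin> disk \<Longrightarrow> f z = 0"
    and "integrable lborel G" "\<And>z. z \<in> disk \<Longrightarrow> (cmod (f z))\<^sup>2 \<le> G z"  "\<And>z. G z \<ge> 0"
  shows "f \<in> bergman"
proof -
  have [measurable]: "f \<in> borel_measurable borel" using assms by (intro borel_measurable_holomorphic_on_disk) auto
  have "(cmod (f z))\<^sup>2 \<le> G z" for z using assms(2)[of z] assms(4)[of z] assms(5)[of z] by (cases "z \<in> disk") auto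
  hence "integrable lborel (\<lambda>z. (cmod (f z))\<^sup>2)"
    by (intro Bochner_Integration.integrable_bound[OF assms(3)]) (use assms(5) in auto)
  thus ?thesis using assms by (auto simp: bergman_iff)
qed

lemma bergman_mult_bounded:
  assumes "f \<in> bergman" "\<phi> holomorphic_on disk" "\<And>z. z \<in> disk \<Longrightarrow> cmod (\<phi> z) \<le> B"
  shows "(\<lambda>z. \<phi> z * f z) \<in> bergman"
proof (rule bergman_dominated)
  show "(\<lambda>z. \<phi> z * f z) holomorphic_on disk"
    using assms bergmanD by (intro holomorphic_intros) auto
  show "integrable lborel (\<lambda>z. B\<^sup>2 * (cmod (f z))\<^sup>2)"
    using bergmanD(3)[OF assms(1)] by simp
  show "(cmod (\<phi> z * f z))\<^sup>2 \<le> B\<^sup>2 * (cmod (f z))\<^sup>2" if "z \<in> disk" for z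
    using assms(3)[OF that] by (auto simp: norm_mult power_mult_distrib intro!: mult_right_mono power_mono)
qed (use bergmanD(2)[OF assms(1)] in auto)

lemma bergman_mult_entire:
  assumes "f \<in> bergman" "\<phi> holomorphic_on UNIV"
  shows "(\<lambda>z. \<phi> z * f z) \<in> bergman"
proof -
  have "compact (\<phi> ` cball 0 1)"
    by (intro compact_continuous_image holomorphic_on_imp_continuous_on holomorphic_on_subset[OF assms(2)]) auto
  then obtain B where B: "\<And>z. z \<in> cball 0 1 \<Longrightarrow> cmod (\<phi> z) \<le> B"
    by (meson bounded_iff compact_imp_bounded imageI)
  show ?thesis
    by (rule bergman_mult_bounded[of _ _ B])
      (use assms B in \<open>auto simp: disk_def intro: holomorphic_on_subset\<close>)
qed

lemma bergman_cmult: "f \<in> bergman \<Longrightarrow> (\<lambda>z. c * f z) \<in> bergman"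
  by (intro bergman_mult_entire) auto

lemma bergman_diff:
  assumes f: "f \<in> bergman" and g: "g \<in> bergman"
  shows "(\<lambda>z. f z - g z) \<in> bergman"
proof (rule bergman_dominated)
  show "(\<lambda>z. f z - g z) holomorphic_on disk"
    using f g bergmanD by (intro holomorphic_intros) auto
  show "integrable lborel (\<lambda>z. 2 * (cmod (f z))\<^sup>2 + 2 * (cmod (g z))\<^sup>2)"
    using bergmanD(3)[OF f] bergmanD(3)[OF g] by simp
  show "(cmod (f z - g z))\<^sup>2 \<le> 2 * (cmod (f z))\<^sup>2 + 2 * (cmod (g z))\<^sup>2" for z
  proof -
    have "(cmod (f z - g z))\<^sup>2 \<le> (cmod (f z) + cmod (g z))\<^sup>2"
      by (intro power_mono norm_triangle_ineq4) auto
    also have "\<dots> \<le> 2 * (cmod (f z))\<^sup>2 + 2 * (cmod (g z))\<^sup>2"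
      using sum_squares_bound[of "cmod (f z)" "cmod (g z)"] by (simp add: power2_sum)
    finally show ?thesis .
  qed
qed (use bergmanD(2)[OF f] bergmanD(2)[OF g] in auto)

text \<open>By continuity a nonzero value persists on a small ball, which has positive
  measure.\<close>

lemma bergman_AE_zero:
  assumes f: "f \<in> bergman" and "AE z in lborel. f z = 0"
  shows "f = (\<lambda>z. 0)"
proof (rule ccontr)
  assume "f \<noteq> (\<lambda>z. 0)"
  then obtain z where z: "f z \<noteq> 0" by auto
  have zd: "z \<in> disk" using z bergmanD(2)[OF f] by blast
  have "open (disk \<inter> f -` (- {0}))"
    by (intro continuous_open_preimage holomorphic_on_imp_continuous_on bergmanD(1)[OF f]) auto
  then obtain e where e: "e > 0" "ball z e \<subseteq> disk \<inter> f -` (- {0})"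
    using z zd unfolding open_contains_ball by (metis ComplI IntI singletonD vimageI)
  have "AE x in lborel. x \<notin> ball z e" using assms(2) by eventually_elim (use e in auto)
  hence "emeasure lborel (ball z e) = 0"
    by (subst (asm) AE_iff_measurable[of "ball z e"]) auto
  hence "measure lborel (ball z e) = 0" by (simp add: measure_def)
  thus False using content_ball_pos[OF e(1), of z] by simp
qed

lemma bergman_norm_zero:
  assumes f: "f \<in> bergman" and "(LINT z|lborel. (cmod (f z))\<^sup>2) = 0"
  shows "f = (\<lambda>z. 0)"
proof -
  have "AE z in lborel. (cmod (f z))\<^sup>2 = 0"
    using assms(2) by (subst (asm) integral_nonneg_eq_0_iff_AE[OF bergmanD(3)[OF f]]) auto
  thus ?thesis by (intro bergman_AE_zero[OF f]) auto
qed

section \<open>Toeplitz operators with entire symbols and their commutants\<close>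

lemma bergman_proj_ident:
  assumes f: "f \<in> bergman"
  shows "bergman_proj f = f"
  unfolding bergman_proj_def
proof (rule the_equality)
  show "f \<in> bergman \<and> (\<forall>k\<in>bergman. l2_inner (\<lambda>z. f z - f z) k = 0)"
    using f by (simp add: l2_inner_def)
next
  fix g assume g: "g \<in> bergman \<and> (\<forall>k\<in>bergman. l2_inner (\<lambda>z. f z - g z) k = 0)"
  \<comment> \<open>Uniqueness for the definite description: the difference lies in the Bergman
    space, so it may be tested against itself.\<close>
  define k where "k = (\<lambda>z. f z - g z)"
  have k: "k \<in> bergman" unfolding k_def using f g by (intro bergman_diff) auto
  have "l2_inner k k = 0" using g k unfolding k_def by blast
  hence "(LINT z:disk|lborel. k z * cnj (k z)) = 0" by (simp add: l2_inner_def)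
  also have "(LINT z:disk|lborel. k z * cnj (k z)) = (LINT z|lborel. complex_of_real ((cmod (k z))\<^sup>2))"
    unfolding set_lebesgue_integral_def
  proof (rule Bochner_Integration.integral_cong)
    show "indicator disk z *\<^sub>R (k z * cnj (k z)) = complex_of_real ((cmod (k z))\<^sup>2)" for z
      unfolding complex_norm_square using bergmanD(2)[OF k, of z] by (cases "z \<in> disk") auto
  qed simp
  also have "\<dots> = complex_of_real (LINT z|lborel. (cmod (k z))\<^sup>2)"
    by (rule integral_complex_of_real)
  finally have "k = (\<lambda>z. 0)" by (intro bergman_norm_zero[OF k]) simp
  thus "g = f" by (auto simp: k_def fun_eq_iff)
qed

text \<open>Multiplication by an entire function stays in the Bergman space, where the projection is
  the identity.\<close>

lemma toeplitz_entire:
  assumes "f \<in> bergman" "\<phi> holomorphic_on UNIV"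
  shows "toeplitz \<phi> f = (\<lambda>z. \<phi> z * f z)"
  unfolding toeplitz_def by (rule bergman_proj_ident[OF bergman_mult_entire[OF assms]])

lemma bounded_opD:
  assumes "bounded_op S"
  shows "f \<in> bergman \<Longrightarrow> S f \<in> bergman"
    and "f \<in> bergman \<Longrightarrow> g \<in> bergman \<Longrightarrow> S (\<lambda>z. f z + g z) = (\<lambda>z. S f z + S g z)"
    and "f \<in> bergman \<Longrightarrow> S (\<lambda>z. c * f z) = (\<lambda>z. c * S f z)"
  using assms unfolding bounded_op_def by blast+

lemma bounded_op_diff:
  assumes S: "bounded_op S" and f: "f \<in> bergman" and g: "g \<in> bergman"
  shows "S (\<lambda>z. f z - c * g z) = (\<lambda>z. S f z - c * S g z)"
  using bounded_opD(2)[OF S f bergman_cmult[OF g, of "-c"]] bounded_opD(3)[OF S g, of "-c"] by simp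

lemma holomorphic_divdiff [holomorphic_intros]:
  "f holomorphic_on A \<Longrightarrow> (\<lambda>z. divdiff h (f z) v) holomorphic_on A"
  unfolding divdiff_def by (intro holomorphic_intros)

lemma (in primitive_poly) commutant_shift:
  assumes m: "m > 0" and S: "bounded_op S"
    and comm: "\<And>f. f \<in> bergman \<Longrightarrow> S (\<lambda>z. poly h (z ^ m) * f z) = (\<lambda>z. poly h (z ^ m) * S f z)"
    and f: "f \<in> bergman"
  shows "S (\<lambda>z. z ^ m * f z) = (\<lambda>z. z ^ m * S f z)"
proof -
  obtain V where V: "open V" "V \<noteq> {}" "V \<subseteq> ball 0 1" "\<And>u v. v \<in> V \<Longrightarrow> u \<in> cball 0 1 \<Longrightarrow> divdiff h u v \<noteq> 0"
    using exists_open_simple_values by blast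
  define W where "W = (\<lambda>w. w ^ m) -` V"
  have Wd: "W \<subseteq> disk"
  proof
    fix w assume "w \<in> W"
    hence "cmod w ^ m < 1" using V(3) by (auto simp: W_def norm_power)
    thus "w \<in> disk" by (metis in_disk_iff linorder_not_less one_le_power)
  qed
  have oW: "open W" unfolding W_def by (intro open_vimage V continuous_intros)
  have neW: "W \<noteq> {}"
  proof -
    obtain v where v: "v \<in> V" using V by blast
    obtain w where "v = w ^ m" using exists_complex_root[of m v] m by blast
    thus ?thesis using v by (auto simp: W_def)
  qed
  have zmf: "(\<lambda>z. z ^ m * f z) \<in> bergman" by (intro bergman_mult_entire f holomorphic_intros)
  \<comment> \<open>Since \<open>z\<^sup>m - v = (h(z\<^sup>m) - h(v)) / divdiff h (z\<^sup>m) v\<close> with a bounded reciprocal factor, the function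
    \<open>(z\<^sup>m - v) f\<close> lies in the range of \<open>h(z\<^sup>m) - h(v)\<close>, which S preserves.\<close>
  have key: "S (\<lambda>z. z ^ m * f z) w = w ^ m * S f w" if w: "w \<in> W" for w
  proof -
    define v where "v = w ^ m"
    have v: "v \<in> V" using w by (simp add: v_def W_def)
    define \<psi> where "\<psi> = (\<lambda>z. inverse (divdiff h (z ^ m) v))"
    define g where "g = (\<lambda>z. \<psi> z * f z)"
    have cb: "z ^ m \<in> cball 0 1" if "z \<in> cball 0 1" for z :: complex
      using that by (simp add: norm_power power_le_one)
    have nz: "divdiff h (z ^ m) v \<noteq> 0" if "z \<in> cball 0 1" for z
      using V(4)[OF v cb[OF that]] .
    have "continuous_on (cball 0 1) \<psi>" unfolding \<psi>_def
      by (intro holomorphic_on_imp_continuous_on holomorphic_intros nz)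
    \<comment> \<open>Nonvanishing on the closed disk, not just the open one, is what bounds the
      reciprocal.\<close>
    hence "bounded (\<psi> ` cball 0 1)" by (intro compact_imp_bounded compact_continuous_image) auto
    then obtain B where B: "\<And>z. z \<in> cball 0 1 \<Longrightarrow> cmod (\<psi> z) \<le> B"
      by (meson bounded_iff imageI)
    have g: "g \<in> bergman" unfolding g_def
    proof (rule bergman_mult_bounded[OF f, of _ B])
      show "\<psi> holomorphic_on disk" unfolding \<psi>_def
        by (intro holomorphic_intros nz) (auto simp: disk_def)
    qed (use B in \<open>auto simp: disk_def\<close>)
    have eq: "(\<lambda>z. z ^ m * f z - v * f z) = (\<lambda>z. poly h (z ^ m) * g z - poly h v * g z)"
    proof
      fix z
      show "z ^ m * f z - v * f z = poly h (z ^ m) * g z - poly h v * g z"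
      proof (cases "z \<in> disk")
        case True
        hence "divdiff h (z ^ m) v \<noteq> 0" by (intro nz) (auto simp: disk_def)
        moreover have "poly h (z ^ m) * g z - poly h v * g z = (z ^ m - v) * divdiff h (z ^ m) v * g z"
          unfolding divdiff by (simp add: algebra_simps)
        ultimately show ?thesis by (simp add: g_def \<psi>_def algebra_simps)
      qed (use bergmanD(2)[OF f] in \<open>auto simp: g_def\<close>)
    qed
    have hg: "(\<lambda>z. poly h (z ^ m) * g z) \<in> bergman" by (intro bergman_mult_entire g holomorphic_intros)
    have "(\<lambda>z. S (\<lambda>z. z ^ m * f z) z - v * S f z) = (\<lambda>z. poly h (z ^ m) * S g z - poly h v * S g z)"
      using arg_cong[OF eq, of S] bounded_op_diff[OF S zmf f] bounded_op_diff[OF S hg g] comm[OF g] by simp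
    \<comment> \<open>At z = w the right-hand side vanishes because h(w^m) = h(v).\<close>
    from fun_cong[OF this, of w] show ?thesis by (simp add: v_def)
  qed
  show ?thesis
  proof
    fix z
    show "S (\<lambda>z. z ^ m * f z) z = z ^ m * S f z"
    proof (cases "z \<in> disk")
      case True
      show ?thesis
        by (rule analytic_continuation_open[OF oW open_disk neW connected_disk Wd _ _ key True])
           (use bergmanD(1) bounded_opD(1)[OF S] f zmf in \<open>auto intro!: holomorphic_intros\<close>)
    next
      case False
      thus ?thesis using bergmanD(2)[OF bounded_opD(1)[OF S zmf]] bergmanD(2)[OF bounded_opD(1)[OF S f]] by simp
    qed
  qed
qed

section \<open>Rotation invariance and circle means\<close>

lemma nn_integral_lborel_translate:
  fixes f :: "'a::euclidean_space \<Rightarrow> ennreal"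
  assumes [measurable]: "f \<in> borel_measurable borel"
  shows "(\<integral>\<^sup>+x. f (x + a) \<partial>lborel) = (\<integral>\<^sup>+x. f x \<partial>lborel)"
  by (subst (2) lborel_distr_plus[of a, symmetric]) (simp add: nn_integral_distr add.commute)

lemma nn_integral_lborel_reflect:
  fixes f :: "'a::euclidean_space \<Rightarrow> ennreal"
  assumes [measurable]: "f \<in> borel_measurable borel"
  shows "(\<integral>\<^sup>+x. f (a - x) \<partial>lborel) = (\<integral>\<^sup>+x. f x \<partial>lborel)"
proof -
  have "(\<integral>\<^sup>+x. f x \<partial>lborel) = (\<integral>\<^sup>+x. f x \<partial>distr lborel borel (\<lambda>x. a + (-1) *\<^sub>R x))"
    by (subst lborel_affine[of "-1" a]) (auto simp: density_1)
  thus ?thesis by (simp add: nn_integral_distr)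
qed

text \<open>Comparing both measures by Fubini with a rotation-invariant set of finite positive measure,
  as in the proof of the uniqueness of Haar measure.\<close>

lemma nn_integral_lborel_rotate:
  fixes g :: "complex \<Rightarrow> ennreal"
  assumes c: "cmod c = 1" and [measurable]: "g \<in> borel_measurable borel"
  shows "(\<integral>\<^sup>+y. g (c * y) \<partial>lborel) = (\<integral>\<^sup>+y. g y \<partial>lborel)"
proof -
  have c0: "c \<noteq> 0" using c by auto
  define f :: "complex \<Rightarrow> ennreal" where "f = indicator (ball 0 1)"
  have [measurable]: "f \<in> borel_measurable borel" unfolding f_def by (rule borel_measurable_indicator) simp
  have fc: "f (c * y) = f y" for y using c by (simp add: f_def indicator_def norm_mult)
  define M where "M = (\<integral>\<^sup>+x. f x \<partial>lborel)"
  have M: "M = emeasure lborel (ball (0::complex) 1)" unfolding M_def f_def by simp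
  have M0: "M \<noteq> 0" using content_ball_pos[of 1 "0::complex"] unfolding M by (simp add: measure_def zero_less_iff_neq_zero enn2real_positive_iff)
  have Mf: "M \<noteq> top" unfolding M using emeasure_lborel_ball_finite[of "0::complex" 1] by simp
  have "M * (\<integral>\<^sup>+y. g (c * y) \<partial>lborel) = (\<integral>\<^sup>+y. g (c * y) * (\<integral>\<^sup>+x. f x \<partial>lborel) \<partial>lborel)"
    unfolding M_def by (subst nn_integral_multc) (simp_all add: mult.commute)
  also have "\<dots> = (\<integral>\<^sup>+y. (\<integral>\<^sup>+x. g (c * y) * f (x + c * y) \<partial>lborel) \<partial>lborel)"
    by (simp add: nn_integral_cmult nn_integral_lborel_translate)
  also have "\<dots> = (\<integral>\<^sup>+x. (\<integral>\<^sup>+y. g (c * y) * f (x + c * y) \<partial>lborel) \<partial>lborel)"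
    by (rule lborel_pair.Fubini') measurable
  also have "\<dots> = (\<integral>\<^sup>+x. (\<integral>\<^sup>+y. g (c * y - x) * f (c * y) \<partial>lborel) \<partial>lborel)"
  proof (rule nn_integral_cong)
    fix x :: complex
    \<comment> \<open>Translating y by -x/c moves x from the argument of f into that of g.\<close>
    have "(\<integral>\<^sup>+y. g (c * y) * f (x + c * y) \<partial>lborel)
        = (\<integral>\<^sup>+y. g (c * (y + - (x / c))) * f (x + c * (y + - (x / c))) \<partial>lborel)"
      by (rule nn_integral_lborel_translate[symmetric]) measurable
    also have "\<dots> = (\<integral>\<^sup>+y. g (c * y - x) * f (c * y) \<partial>lborel)"
      using c0 by (simp add: algebra_simps)
    finally show "(\<integral>\<^sup>+y. g (c * y) * f (x + c * y) \<partial>lborel) = (\<integral>\<^sup>+y. g (c * y - x) * f (c * y) \<partial>lborel)" .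
  qed
  also have "\<dots> = (\<integral>\<^sup>+y. (\<integral>\<^sup>+x. g (c * y - x) * f (c * y) \<partial>lborel) \<partial>lborel)"
    by (rule lborel_pair.Fubini'[symmetric]) measurable
  also have "\<dots> = (\<integral>\<^sup>+y. (\<integral>\<^sup>+x. g x \<partial>lborel) * f y \<partial>lborel)"
    by (simp add: nn_integral_multc nn_integral_lborel_reflect fc)
  also have "\<dots> = M * (\<integral>\<^sup>+x. g x \<partial>lborel)"
    unfolding M_def by (subst nn_integral_cmult) (simp_all add: mult.commute)
  finally show ?thesis using M0 Mf by (simp add: ennreal_mult_cancel_left)
qed

definition taylor_coeff :: "(complex \<Rightarrow> complex) \<Rightarrow> nat \<Rightarrow> complex" where
  "taylor_coeff g k = (deriv ^^ k) g 0 / fact k"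

text \<open>Cauchy's formula for u -> g(z u) on the unit circle writes the k-th Taylor term at z as
  a mean of values of modulus |g|; Cauchy-Schwarz passes to the mean square.\<close>

lemma taylor_coeff_circle_mean:
  assumes g: "g holomorphic_on disk" and z: "z \<in> disk"
  shows "ennreal ((cmod (taylor_coeff g k * z ^ k))\<^sup>2)
     \<le> (\<integral>\<^sup>+t. ennreal ((cmod (g (circlepath 0 1 t * z)))\<^sup>2) * indicator {0..1} t \<partial>lborel)"
proof -
  define \<phi> where "\<phi> = (\<lambda>u. g (z * u))"
  define e where "e = circlepath 0 1"
  have e: "e t = exp (2 * of_real pi * \<i> * of_real t)" for t by (simp add: e_def circlepath)
  have ne: "cmod (e t) = 1" for t by (simp add: e norm_exp_eq_Re)
  have uz: "z * u \<in> disk" if "u \<in> cball 0 1" for u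
  proof -
    have "cmod z * cmod u \<le> cmod z * 1" using that by (intro mult_left_mono) auto
    thus ?thesis using z by (simp add: in_disk_iff norm_mult)
  qed
  have hol: "\<phi> holomorphic_on cball 0 1" unfolding \<phi>_def
    by (rule holomorphic_on_compose_gen[OF _ g, unfolded o_def]) (use uz in \<open>auto intro!: holomorphic_intros\<close>)
  have "(deriv ^^ k) \<phi> 0 = z ^ k * (deriv ^^ k) g (z * 0)" unfolding \<phi>_def
    by (rule higher_deriv_compose_linear[OF g _ _ _, of "ball 0 1"]) (use uz in auto)
  hence dk: "(deriv ^^ k) \<phi> 0 / fact k = taylor_coeff g k * z ^ k" by (simp add: taylor_coeff_def)
  have "((\<lambda>u. \<phi> u / (u-0) ^ (Suc k)) has_contour_integral ((2 * pi * \<i>) / (fact k) * (deriv ^^ k) \<phi> 0)) (circlepath 0 1)"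
    by (rule Cauchy_has_contour_integral_higher_derivative_circlepath)
       (use hol in \<open>auto intro: holomorphic_on_imp_continuous_on holomorphic_on_subset\<close>)
  hence "((\<lambda>t. \<phi> (e t) / (e t - 0) ^ Suc k * vector_derivative (circlepath 0 1) (at t)) has_integral
      (2 * pi * \<i>) / (fact k) * (deriv ^^ k) \<phi> 0) {0..1}"
    unfolding has_contour_integral e_def .
  also have "(\<lambda>t. \<phi> (e t) / (e t - 0) ^ Suc k * vector_derivative (circlepath 0 1) (at t))
      = (\<lambda>t. 2 * pi * \<i> * (\<phi> (e t) / e t ^ k))"
  proof
    fix t
    have 0: "e t \<noteq> 0" using ne[of t] by auto
    have "vector_derivative (circlepath 0 1) (at t) = 2 * pi * \<i> * e t"
      by (simp add: vector_derivative_circlepath e)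
    thus "\<phi> (e t) / (e t - 0) ^ Suc k * vector_derivative (circlepath 0 1) (at t) = 2 * pi * \<i> * (\<phi> (e t) / e t ^ k)"
      using 0 by simp
  qed
  also have "(2 * pi * \<i>) / (fact k) * (deriv ^^ k) \<phi> 0 = (2 * pi * \<i>) * (taylor_coeff g k * z ^ k)"
    unfolding dk[symmetric] by simp
  finally have "((\<lambda>t. inverse (2 * pi * \<i>) * (2 * pi * \<i> * (\<phi> (e t) / e t ^ k))) has_integral
       inverse (2 * pi * \<i>) * ((2 * pi * \<i>) * (taylor_coeff g k * z ^ k))) {0..1}"
    by (rule has_integral_mult_right)
  also have "(\<lambda>t. inverse (2 * pi * \<i>) * (2 * pi * \<i> * (\<phi> (e t) / e t ^ k))) = (\<lambda>t. \<phi> (e t) / e t ^ k)"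
    by (simp add: field_simps)
  also have "inverse (2 * pi * \<i>) * ((2 * pi * \<i>) * (taylor_coeff g k * z ^ k)) = taylor_coeff g k * z ^ k"
    by (simp add: field_simps)
  finally have int: "((\<lambda>t. \<phi> (e t) / e t ^ k) has_integral (taylor_coeff g k * z ^ k)) {0..1}" .
  define s where "s = cmod (taylor_coeff g k * z ^ k)"
  define J where "J = integral {0..1} (\<lambda>t. (cmod (\<phi> (e t)))\<^sup>2)"
  have "continuous_on {0..1} (\<lambda>t. \<phi> (e t))"
    by (rule continuous_on_compose2[OF holomorphic_on_imp_continuous_on[OF hol]])
       (auto simp: e norm_exp_eq_Re intro!: continuous_intros)
  hence i2: "(\<lambda>t. (cmod (\<phi> (e t)))\<^sup>2) integrable_on {0..1}"
    by (intro integrable_continuous_interval continuous_intros)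
  hence J: "((\<lambda>t. (cmod (\<phi> (e t)))\<^sup>2) has_integral J) {0..1}" unfolding J_def by (rule integrable_integral)
  \<comment> \<open>Cauchy-Schwarz by way of 2 s x \<le> s^2 + x^2: integrating gives s \<le> s/2 +
    J/(2 s).\<close>
  have "s\<^sup>2 \<le> J"
  proof (cases "s = 0")
    case True
    have "J \<ge> 0" using J by (rule has_integral_nonneg) auto
    thus ?thesis using True by simp
  next
    case False
    hence s: "s > 0" by (simp add: s_def)
    have cs: "((\<lambda>t. s / 2 + (cmod (\<phi> (e t)))\<^sup>2 / (2 * s)) has_integral s / 2 + J / (2 * s)) {0..1}"
      using has_integral_add[OF _ has_integral_divide[OF J, of "2 * s"], of "\<lambda>_. s / 2" "s / 2"]
        has_integral_const_real[of "s / 2" 0 1] by simp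
    have "cmod (integral {0..1} (\<lambda>t. \<phi> (e t) / e t ^ k)) \<le> integral {0..1} (\<lambda>t. s / 2 + (cmod (\<phi> (e t)))\<^sup>2 / (2 * s))"
    proof (rule integral_norm_bound_integral[OF has_integral_integrable[OF int] has_integral_integrable[OF cs]])
      show "cmod (\<phi> (e t) / e t ^ k) \<le> s / 2 + (cmod (\<phi> (e t)))\<^sup>2 / (2 * s)" for t
      proof -
        have "2 * s * cmod (\<phi> (e t)) \<le> s\<^sup>2 + (cmod (\<phi> (e t)))\<^sup>2" by (rule sum_squares_bound)
        hence "cmod (\<phi> (e t)) \<le> s / 2 + (cmod (\<phi> (e t)))\<^sup>2 / (2 * s)"
          using s by (simp add: field_simps power2_eq_square)
        thus ?thesis by (simp add: norm_divide norm_power ne)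
      qed
    qed
    hence "s \<le> s / 2 + J / (2 * s)"
      unfolding integral_unique[OF int] integral_unique[OF cs] s_def[symmetric] .
    thus ?thesis using s by (simp add: field_simps power2_eq_square)
  qed
  hence "ennreal (s\<^sup>2) \<le> ennreal J" by (rule ennreal_leI)
  also have "ennreal J = (\<integral>\<^sup>+t. ennreal ((cmod (\<phi> (e t)))\<^sup>2) * indicator {0..1} t \<partial>lborel)"
    using J by (intro nn_integral_has_integral_lebesgue'[symmetric]) auto
  finally show ?thesis by (simp add: s_def \<phi>_def e_def mult.commute)
qed

text \<open>The integral on the right is unchanged when g is rotated. Averaging over all rotations
  and exchanging integrals reduces the claim to the pointwise circle bound, so one Taylor
  coefficient controls every z^j g from below.\<close>

lemma nn_integral_taylor_coeff_le:
  assumes g: "g \<in> bergman"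
  shows "(\<integral>\<^sup>+z. ennreal ((cmod (taylor_coeff g k))\<^sup>2 * cmod z ^ (2 * (j + k))) * indicator disk z \<partial>lborel)
     \<le> (\<integral>\<^sup>+z. ennreal ((cmod (z ^ j * g z))\<^sup>2) \<partial>lborel)"
proof -
  have [measurable]: "g \<in> borel_measurable borel" using bergmanD(4)[OF g] .
  define e where "e = circlepath 0 1"
  have e: "e t = exp (2 * of_real pi * \<i> * of_real t)" for t by (simp add: e_def circlepath)
  have ne: "cmod (e t) = 1" for t by (simp add: e norm_exp_eq_Re)
  have "continuous_on UNIV e" unfolding e by (intro continuous_intros)
  hence [measurable]: "e \<in> borel_measurable borel" by (rule borel_measurable_continuous_onI)
  define I where "I = (\<integral>\<^sup>+z. ennreal ((cmod (z ^ j * g z))\<^sup>2) \<partial>lborel)"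
  have rot: "I = (\<integral>\<^sup>+z. ennreal ((cmod (z ^ j * g (e t * z)))\<^sup>2) \<partial>lborel)" for t
  proof -
    have "I = (\<integral>\<^sup>+z. ennreal ((cmod ((e t * z) ^ j * g (e t * z)))\<^sup>2) \<partial>lborel)"
      unfolding I_def by (rule nn_integral_lborel_rotate[OF ne, symmetric]) measurable
    thus ?thesis by (simp add: norm_mult norm_power ne)
  qed
  have "(\<integral>\<^sup>+z. ennreal ((cmod (taylor_coeff g k))\<^sup>2 * cmod z ^ (2 * (j + k))) * indicator disk z \<partial>lborel)
    \<le> (\<integral>\<^sup>+z. (\<integral>\<^sup>+t. ennreal ((cmod (z ^ j * g (e t * z)))\<^sup>2) * indicator {0..1} t \<partial>lborel) \<partial>lborel)"
  proof (intro nn_integral_mono)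
    fix z
    have "ennreal ((cmod (taylor_coeff g k))\<^sup>2 * cmod z ^ (2 * (j + k)))
      = ennreal ((cmod (z ^ j))\<^sup>2) * ennreal ((cmod (taylor_coeff g k * z ^ k))\<^sup>2)"
      by (simp add: ennreal_mult[symmetric] norm_mult norm_power power_mult_distrib power_add power_mult mult_ac flip: power_mult)
    also have "\<dots> \<le> ennreal ((cmod (z ^ j))\<^sup>2) * 
        (\<integral>\<^sup>+t. ennreal ((cmod (g (e t * z)))\<^sup>2) * indicator {0..1} t \<partial>lborel)" if "z \<in> disk"
      using taylor_coeff_circle_mean[OF bergmanD(1)[OF g] that] unfolding e_def by (intro mult_left_mono) auto
    also have "ennreal ((cmod (z ^ j))\<^sup>2) * 
        (\<integral>\<^sup>+t. ennreal ((cmod (g (e t * z)))\<^sup>2) * indicator {0..1} t \<partial>lborel)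
      = (\<integral>\<^sup>+t. ennreal ((cmod (z ^ j * g (e t * z)))\<^sup>2) * indicator {0..1} t \<partial>lborel)"
      by (subst nn_integral_cmult[symmetric])
         (auto simp: norm_mult power_mult_distrib ennreal_mult mult.assoc)
    finally show "ennreal ((cmod (taylor_coeff g k))\<^sup>2 * cmod z ^ (2 * (j + k))) * indicator disk z
      \<le> (\<integral>\<^sup>+t. ennreal ((cmod (z ^ j * g (e t * z)))\<^sup>2) * indicator {0..1} t \<partial>lborel)"
      by (cases "z \<in> disk") auto
  qed
  also have "\<dots> = (\<integral>\<^sup>+t. (\<integral>\<^sup>+z. ennreal ((cmod (z ^ j * g (e t * z)))\<^sup>2) * indicator {0..1} t \<partial>lborel) \<partial>lborel)"
    by (rule lborel_pair.Fubini') measurable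
  also have "\<dots> = (\<integral>\<^sup>+t. I * indicator {0..1::real} t \<partial>lborel)"
    by (intro nn_integral_cong, subst nn_integral_multc) (auto simp flip: rot)
  also have "\<dots> = I" by (subst nn_integral_cmult_indicator) auto
  finally show ?thesis unfolding I_def .
qed

section \<open>Compact operators commuting with a power of the shift\<close>

text \<open>The squared norm of z^k for unnormalised area, that is pi / (k + 1); it serves to
  normalise the powers of z.\<close>

definition moment :: "nat \<Rightarrow> real" where
  "moment k = (LINT z|lborel. indicator disk z * cmod z ^ (2 * k))"

lemma finite_disk: "emeasure lborel disk < \<infinity>"
  unfolding disk_def by (rule emeasure_lborel_ball_finite)

lemma integrable_indicator_disk [simp]: "integrable lborel (indicator disk :: complex \<Rightarrow> real)"
  using finite_disk by (intro integrable_real_indicator) auto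

lemma integrable_moment: "integrable lborel (\<lambda>z. indicator disk z * cmod z ^ (2 * k))"
  by (rule Bochner_Integration.integrable_bound[OF integrable_indicator_disk])
     (auto simp: indicator_def in_disk_iff power_le_one)

lemma nn_integral_moment:
  "(\<integral>\<^sup>+z. ennreal (cmod z ^ (2 * k)) * indicator disk z \<partial>lborel) = ennreal (moment k)"
proof -
  have "(\<integral>\<^sup>+z. ennreal (cmod z ^ (2 * k)) * indicator disk z \<partial>lborel)
      = (\<integral>\<^sup>+z. ennreal (indicator disk z * cmod z ^ (2 * k)) \<partial>lborel)"
    by (intro nn_integral_cong) (auto simp: indicator_def)
  also have "\<dots> = ennreal (moment k)"
    unfolding moment_def by (rule nn_integral_eq_integral[OF integrable_moment]) auto
  finally show ?thesis .
qed

lemma measure_complex_ball: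
  "r \<ge> 0 \<Longrightarrow> measure lborel (ball (c::complex) r) = measure lborel disk * r\<^sup>2"
  "r \<ge> 0 \<Longrightarrow> measure lborel (cball (c::complex) r) = measure lborel disk * r\<^sup>2"
  by (simp_all add: disk_def content_ball content_cball)

lemma measure_disk_pos: "measure lborel disk > 0"
  unfolding disk_def by (rule content_ball_pos) simp

lemma measure_disk_annulus:
  assumes "0 \<le> s" "s < 1"
  shows "measure lborel (disk - cball 0 s) = measure lborel disk * (1 - s\<^sup>2)"
proof -
  have "measure lborel (disk - cball 0 s) = measure lborel disk - measure lborel (cball (0::complex) s)"
    by (rule measure_Diff) (use finite_disk assms in \<open>auto simp: disk_def\<close>)
  thus ?thesis using assms by (simp add: measure_complex_ball algebra_simps)
qed

text \<open>Integrate only over the annulus outside radius s, where the integrand is at least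
  s^(2k).\<close>

lemma moment_ge:
  assumes "0 \<le> s" "s < 1"
  shows "moment k \<ge> s ^ (2 * k) * (measure lborel disk * (1 - s\<^sup>2))"
proof -
  have fin: "emeasure lborel (disk - cball 0 s) < \<infinity>"
    by (rule le_less_trans[OF emeasure_mono finite_disk]) auto
  have "s ^ (2 * k) * (measure lborel disk * (1 - s\<^sup>2))
      = (LINT z|lborel. s ^ (2 * k) * indicator (disk - cball 0 s) z)"
    using assms by (simp add: measure_disk_annulus)
  also have "\<dots> \<le> moment k" unfolding moment_def
  proof (rule integral_mono[OF _ integrable_moment])
    show "integrable lborel (\<lambda>z. s ^ (2 * k) * indicator (disk - cball 0 s) z :: real)"
      using fin by (intro integrable_mult_right integrable_real_indicator) auto
    show "s ^ (2 * k) * indicator (disk - cball 0 s) z \<le> indicator disk z * cmod z ^ (2 * k)" for z :: complex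
      using assms by (auto simp: indicator_def intro!: power_mono)
  qed
  finally show ?thesis .
qed

lemma moment_pos: "moment k > 0"
proof -
  have "(1/2::real) ^ (2 * k) * (measure lborel disk * (1 - (1/2)\<^sup>2)) > 0"
    using measure_disk_pos by (simp add: power2_eq_square)
  with moment_ge[of "1/2" k] show ?thesis by linarith
qed

text \<open>Off the disk of radius 1/2 the extra factor |z|^(2k) is at least 4^(-k), and the inner
  disk carries at most half of the j-th moment. The constant does not depend on j.\<close>

lemma moment_shift: "moment (j + k) \<ge> moment j / 2 / 4 ^ k"
proof -
  define A where "A = ball (0::complex) (1/2)"
  have A: "measure lborel A = measure lborel disk / 4"
    unfolding A_def by (subst measure_complex_ball) (auto simp: power2_eq_square)
  have fA: "integrable lborel (indicator A :: complex \<Rightarrow> real)"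
    unfolding A_def using emeasure_lborel_ball_finite[of "0::complex" "1/2"]
    by (intro integrable_real_indicator) auto
  have "(moment j - (1/4) ^ j * measure lborel A) / 4 ^ k
    = (LINT z|lborel. (indicator disk z * cmod z ^ (2 * j) - (1/4) ^ j * indicator A z) / 4 ^ k)"
    unfolding moment_def using fA
    by (subst integral_divide_zero, subst Bochner_Integration.integral_diff) (auto intro: integrable_moment simp: A_def)
  also have "\<dots> \<le> moment (j + k)"
    unfolding moment_def
  proof (rule integral_mono[OF _ integrable_moment])
    show "integrable lborel (\<lambda>z. (indicator disk z * cmod z ^ (2 * j) - (1/4) ^ j * indicator A z) / 4 ^ k)"
      using fA integrable_moment by (intro integrable_divide Bochner_Integration.integrable_diff integrable_mult_right) auto
    fix z :: complex
    show "(indicator disk z * cmod z ^ (2 * j) - (1/4) ^ j * indicator A z) / 4 ^ k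
       \<le> indicator disk z * cmod z ^ (2 * (j + k))"
    proof (cases "z \<in> A")
      case True
      hence "cmod z ^ (2 * j) \<le> (1/2) ^ (2 * j)" by (intro power_mono) (auto simp: A_def)
      also have "\<dots> = (1/4) ^ j" by (simp add: power_mult power2_eq_square)
      finally have "(indicator disk z * cmod z ^ (2 * j) - (1/4) ^ j * indicator A z) / 4 ^ k \<le> 0"
        using True by (auto simp: indicator_def divide_le_0_iff)
      also have "0 \<le> indicator disk z * cmod z ^ (2 * (j + k))" by simp
      finally show ?thesis .
    next
      case False
      hence "(1/2) ^ (2 * k) \<le> cmod z ^ (2 * k)" by (intro power_mono) (auto simp: A_def)
      moreover have "(1/2::real) ^ (2 * k) = 1 / 4 ^ k" by (simp add: power_mult power2_eq_square power_divide)
      ultimately have "cmod z ^ (2 * j) * (1 / 4 ^ k) \<le> cmod z ^ (2 * j) * cmod z ^ (2 * k)"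
        by (intro mult_left_mono) auto
      thus ?thesis using False by (auto simp: indicator_def power_add distrib_left)
    qed
  qed
  finally have 1: "(moment j - (1/4) ^ j * measure lborel A) / 4 ^ k \<le> moment (j + k)" .
  have "(1/2::real) ^ (2 * j) * (measure lborel disk * (1 - (1/2)\<^sup>2)) \<le> moment j" by (rule moment_ge) auto
  \<comment> \<open>The moment is at least 3X/4, while the inner disk contributes at most
    X/4.\<close>
  moreover define X where "X = (1/4) ^ j * measure lborel disk"
  ultimately have "X * (3/4) \<le> moment j"
    by (simp add: power_mult power2_eq_square)
  moreover have "X \<ge> 0" using measure_disk_pos by (simp add: X_def)
  moreover have "(1/4) ^ j * measure lborel A = X / 4" by (simp add: A X_def)
  ultimately have "moment j / 2 \<le> moment j - (1/4) ^ j * measure lborel A" by linarith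
  hence "moment j / 2 / 4 ^ k \<le> (moment j - (1/4) ^ j * measure lborel A) / 4 ^ k"
    by (intro divide_right_mono) auto
  with 1 show ?thesis by linarith
qed

text \<open>For s strictly between |z| and 1, \<open>moment_ge\<close> bounds the quotient by a
  geometric sequence of ratio (|z|/s)^2.\<close>

lemma power_over_moment_tendsto_0:
  assumes "z \<in> disk"
  shows "(\<lambda>k. cmod z ^ (2 * k) / moment k) \<longlonglongrightarrow> 0"
proof -
  define \<rho> where "\<rho> = cmod z"
  define s where "s = (1 + \<rho>) / 2"
  have \<rho>: "0 \<le> \<rho>" "\<rho> < 1" using assms by (auto simp: \<rho>_def in_disk_iff)
  have s: "0 < s" "s < 1" "\<rho> < s" using \<rho> by (auto simp: s_def)
  define \<kappa> where "\<kappa> = measure lborel disk * (1 - s\<^sup>2)"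
  have \<kappa>: "\<kappa> > 0" unfolding \<kappa>_def using s measure_disk_pos by (simp add: power_less_one_iff)
  have "(\<lambda>k. ((\<rho> / s)\<^sup>2) ^ k / \<kappa>) \<longlonglongrightarrow> 0 / \<kappa>"
    using s \<rho> \<kappa> by (intro tendsto_divide LIMSEQ_power_zero tendsto_const) (auto simp: power_less_one_iff abs_square_less_1)
  hence lim: "(\<lambda>k. ((\<rho> / s)\<^sup>2) ^ k / \<kappa>) \<longlonglongrightarrow> 0" by simp
  show ?thesis
  proof (rule tendsto_sandwich[OF _ _ tendsto_const lim])
    show "\<forall>\<^sub>F k in sequentially. 0 \<le> cmod z ^ (2 * k) / moment k"
      using moment_pos by (intro always_eventually allI divide_nonneg_nonneg) (auto intro: less_imp_le)
    show "\<forall>\<^sub>F k in sequentially. cmod z ^ (2 * k) / moment k \<le> ((\<rho> / s)\<^sup>2) ^ k / \<kappa>"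
    proof (intro always_eventually allI)
      fix k
      have "s ^ (2 * k) * \<kappa> \<le> moment k" unfolding \<kappa>_def using s by (intro moment_ge) auto
      moreover have "s ^ (2 * k) * \<kappa> > 0" using s \<kappa> by simp
      ultimately have "cmod z ^ (2 * k) / moment k \<le> \<rho> ^ (2 * k) / (s ^ (2 * k) * \<kappa>)"
        unfolding \<rho>_def by (intro divide_left_mono) (auto intro: mult_pos_pos moment_pos)
      thus "cmod z ^ (2 * k) / moment k \<le> ((\<rho> / s)\<^sup>2) ^ k / \<kappa>"
        by (simp add: power_divide power_mult)
    qed
  qed
qed

section \<open>Norm bounds for z^j g and compact operators on bounded functions\<close>

lemma bergman_power_mult: "f \<in> bergman \<Longrightarrow> (\<lambda>z. z ^ k * f z) \<in> bergman"
  by (intro bergman_mult_entire holomorphic_intros)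

text \<open>A nonzero g has a nonzero Taylor coefficient, say the k-th. It yields a bound by moment
  j + k, which \<open>moment_shift\<close> converts to moment j with a factor depending only on
  k.\<close>

lemma bergman_power_mult_norm_ge:
  assumes g: "g \<in> bergman" and "g \<noteq> (\<lambda>z. 0)"
  obtains c where "c > 0" "\<And>j. c * moment j \<le> (LINT z|lborel. (cmod (z ^ j * g z))\<^sup>2)"
proof -
  have "\<exists>k. (deriv ^^ k) g 0 \<noteq> 0"
  proof (rule ccontr)
    assume *: "\<nexists>k. (deriv ^^ k) g 0 \<noteq> 0"
    have "g w = 0" if "w \<in> disk" for w
      by (rule holomorphic_fun_eq_0_on_connected[OF bergmanD(1)[OF g] open_disk connected_disk, of 0])
         (use * that in \<open>auto simp: in_disk_iff\<close>)
    hence "g = (\<lambda>z. 0)" using bergmanD(2)[OF g] by (intro ext) metis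
    with assms(2) show False by simp
  qed
  then obtain k where "taylor_coeff g k \<noteq> 0" by (auto simp: taylor_coeff_def)
  define b where "b = (cmod (taylor_coeff g k))\<^sup>2"
  have b: "b > 0" using \<open>taylor_coeff g k \<noteq> 0\<close> by (simp add: b_def)
  show ?thesis
  proof (rule that[of "b / 2 / 4 ^ k"])
    show "b / 2 / 4 ^ k > 0" using b by simp
    fix j
    have int: "integrable lborel (\<lambda>z. (cmod (z ^ j * g z))\<^sup>2)" by (intro bergmanD(3) bergman_power_mult g)
    have "ennreal (b * moment (j + k)) = ennreal b * ennreal (moment (j + k))"
      using b moment_pos[of "j + k"] by (intro ennreal_mult) auto
    also have "\<dots> = (\<integral>\<^sup>+z. ennreal b * (ennreal (cmod z ^ (2 * (j + k))) * indicator disk z) \<partial>lborel)"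
      unfolding nn_integral_moment[symmetric] by (subst nn_integral_cmult) auto
    also have "\<dots> = (\<integral>\<^sup>+z. ennreal (b * cmod z ^ (2 * (j + k))) * indicator disk z \<partial>lborel)"
      using b by (simp add: ennreal_mult mult.assoc)
    also have "\<dots> \<le> (\<integral>\<^sup>+z. ennreal ((cmod (z ^ j * g z))\<^sup>2) \<partial>lborel)"
      unfolding b_def by (rule nn_integral_taylor_coeff_le[OF g])
    also have "\<dots> = ennreal (LINT z|lborel. (cmod (z ^ j * g z))\<^sup>2)"
      by (rule nn_integral_eq_integral[OF int]) auto
    finally have "b * moment (j + k) \<le> (LINT z|lborel. (cmod (z ^ j * g z))\<^sup>2)"
      by (subst (asm) ennreal_le_iff) auto
    moreover have "b * (moment j / 2 / 4 ^ k) \<le> b * moment (j + k)"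
      using b by (intro mult_left_mono moment_shift) auto
    ultimately show "b / 2 / 4 ^ k * moment j \<le> (LINT z|lborel. (cmod (z ^ j * g z))\<^sup>2)" by simp
  qed
qed

lemma l2_norm_bergman:
  assumes "f \<in> bergman"
  shows "l2_norm f = sqrt ((LINT z|lborel. (cmod (f z))\<^sup>2) / pi)"
proof -
  have "(\<lambda>z. indicator disk z *\<^sub>R (cmod (f z))\<^sup>2) = (\<lambda>z. (cmod (f z))\<^sup>2)"
    using bergmanD(2)[OF assms] by (auto simp: indicator_def fun_eq_iff)
  thus ?thesis by (simp add: l2_norm_def set_lebesgue_integral_def)
qed

lemma iterated_shift:
  fixes S :: "(complex \<Rightarrow> complex) \<Rightarrow> complex \<Rightarrow> complex"
  assumes comm: "\<And>f. f \<in> bergman \<Longrightarrow> S (\<lambda>z. z ^ m * f z) = (\<lambda>z. z ^ m * S f z)" and f: "f \<in> bergman"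
  shows "S (\<lambda>z. z ^ (m * k) * f z) = (\<lambda>z. z ^ (m * k) * S f z)"
proof (induction k)
  case (Suc k)
  have eq: "z ^ (m * Suc k) * x = z ^ m * (z ^ (m * k) * x)" for z x :: complex
    by (simp add: power_add mult.assoc)
  show ?case unfolding eq comm[OF bergman_power_mult[OF f]] Suc.IH by (rule refl)
qed simp

lemma compact_commutant_bounded_zero:
  assumes S: "bounded_op S" and comp: "compact_op S" and m: "m > 0"
    and comm: "\<And>f. f \<in> bergman \<Longrightarrow> S (\<lambda>z. z ^ m * f z) = (\<lambda>z. z ^ m * S f z)"
    and f: "f \<in> bergman" and B: "\<And>z. z \<in> disk \<Longrightarrow> cmod (f z) \<le> B"
  shows "S f = (\<lambda>z. 0)"
proof (rule ccontr)
  assume ne: "S f \<noteq> (\<lambda>z. 0)"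
  define g where "g = S f"
  have g: "g \<in> bergman" unfolding g_def by (rule bounded_opD(1)[OF S f])
  obtain c where c: "c > 0" "\<And>j. c * moment j \<le> (LINT z|lborel. (cmod (z ^ j * g z))\<^sup>2)"
    using bergman_power_mult_norm_ge[OF g] ne g_def by metis
  define a where "a = (\<lambda>n. complex_of_real (1 / sqrt (moment (m * n))))"
  have a2: "(cmod (a n))\<^sup>2 = 1 / moment (m * n)" for n
    using moment_pos[of "m * n"] by (simp add: a_def power_divide norm_divide)
  define F where "F = (\<lambda>n z. a n * (z ^ (m * n) * f z))"
  have F: "F n \<in> bergman" for n unfolding F_def by (intro bergman_cmult bergman_power_mult f)
  have SF: "S (F n) = (\<lambda>z. a n * (z ^ (m * n) * g z))" for n
    unfolding F_def g_def using bounded_opD(3)[OF S bergman_power_mult[OF f]] iterated_shift[of S m, OF comm f] by simp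
  have SFb: "S (F n) \<in> bergman" for n by (rule bounded_opD(1)[OF S F])
  \<comment> \<open>Boundedness of f keeps the normalised sequence bounded in norm.\<close>
  have bd: "l2_norm (F n) \<le> sqrt (B\<^sup>2 / pi)" for n
  proof -
    have "(LINT z|lborel. (cmod (F n z))\<^sup>2) \<le> (LINT z|lborel. B\<^sup>2 / moment (m * n) * (indicator disk z * cmod z ^ (2 * (m * n))))"
    proof (rule integral_mono[OF bergmanD(3)[OF F]])
      show "integrable lborel (\<lambda>z. B\<^sup>2 / moment (m * n) * (indicator disk z * cmod z ^ (2 * (m * n))))"
        by (intro integrable_mult_right integrable_moment)
      fix z
      show "(cmod (F n z))\<^sup>2 \<le> B\<^sup>2 / moment (m * n) * (indicator disk z * cmod z ^ (2 * (m * n)))"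
      proof (cases "z \<in> disk")
        case True
        have "(cmod (F n z))\<^sup>2 = (cmod (f z))\<^sup>2 * (cmod z ^ (2 * (m * n)) / moment (m * n))"
          unfolding F_def norm_mult power_mult_distrib a2 by (simp add: norm_power mult_ac flip: power_mult)
        also have "\<dots> \<le> B\<^sup>2 * (cmod z ^ (2 * (m * n)) / moment (m * n))"
          using B[OF True] moment_pos[of "m * n"] by (intro mult_right_mono power_mono) auto
        finally show ?thesis using True by simp
      next
        case False
        thus ?thesis using bergmanD(2)[OF F False] by simp
      qed
    qed
    also have "\<dots> = B\<^sup>2"
      using moment_pos[of "m * n"] by (simp flip: moment_def)
    finally show ?thesis unfolding l2_norm_bergman[OF F]
      by (intro real_sqrt_le_mono divide_right_mono) auto
  qed
  obtain r G where r: "strict_mono (r :: nat \<Rightarrow> nat)" and G: "G \<in> bergman"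
    and lim: "(\<lambda>n. l2_norm (\<lambda>z. S (F (r n)) z - G z)) \<longlonglongrightarrow> 0"
    using comp F bd unfolding compact_op_def by meson
  define d where "d = (\<lambda>n. LINT z|lborel. (cmod (S (F (r n)) z - G z))\<^sup>2)"
  have db: "(\<lambda>z. S (F (r n)) z - G z) \<in> bergman" for n by (intro bergman_diff SFb G)
  have d0: "d n \<ge> 0" for n unfolding d_def by (rule integral_nonneg_AE) simp
  have "(\<lambda>n. (l2_norm (\<lambda>z. S (F (r n)) z - G z))\<^sup>2 * pi) \<longlonglongrightarrow> 0\<^sup>2 * pi"
    by (intro tendsto_intros lim)
  moreover have "(l2_norm (\<lambda>z. S (F (r n)) z - G z))\<^sup>2 * pi = d n" for n
    using d0[of n] unfolding l2_norm_bergman[OF db] by (simp add: d_def)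
  ultimately have dlim: "d \<longlonglongrightarrow> 0" by simp
  have pt: "(\<lambda>n. S (F (r n)) z) \<longlonglongrightarrow> 0" for z
  proof (cases "z \<in> disk")
    case True
    have "strict_mono (\<lambda>n. m * r n)" using r m by (auto simp: strict_mono_def)
    from LIMSEQ_subseq_LIMSEQ[OF power_over_moment_tendsto_0[OF True] this]
    have "(\<lambda>n. cmod z ^ (2 * (m * r n)) / moment (m * r n)) \<longlonglongrightarrow> 0" by (simp add: o_def)
    hence "(\<lambda>n. sqrt (cmod z ^ (2 * (m * r n)) / moment (m * r n)) * cmod (g z)) \<longlonglongrightarrow> sqrt 0 * cmod (g z)"
      by (intro tendsto_intros)
    also have "(\<lambda>n. sqrt (cmod z ^ (2 * (m * r n)) / moment (m * r n)) * cmod (g z)) = (\<lambda>n. cmod (S (F (r n)) z))"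
    proof
      fix n
      have "sqrt (cmod z ^ (2 * (m * r n)) / moment (m * r n)) = sqrt ((cmod (a (r n)) * cmod z ^ (m * r n))\<^sup>2)"
        unfolding power_mult_distrib a2 by (simp add: mult.commute flip: power_mult)
      thus "sqrt (cmod z ^ (2 * (m * r n)) / moment (m * r n)) * cmod (g z) = cmod (S (F (r n)) z)"
        unfolding SF by (simp add: norm_mult norm_power)
    qed
    finally show ?thesis by (simp add: tendsto_norm_zero_iff)
  next
    case False
    thus ?thesis using bergmanD(2)[OF SFb False] by simp
  qed
  have [measurable]: "G \<in> borel_measurable borel" "S (F n) \<in> borel_measurable borel" for n
    using bergmanD(4)[OF G] bergmanD(4)[OF SFb] by auto
  \<comment> \<open>Fatou's lemma identifies the norm limit G with the pointwise limit 0.\<close>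
  have "(\<integral>\<^sup>+z. ennreal ((cmod (G z))\<^sup>2) \<partial>lborel)
      = (\<integral>\<^sup>+z. liminf (\<lambda>n. ennreal ((cmod (S (F (r n)) z - G z))\<^sup>2)) \<partial>lborel)"
  proof (intro nn_integral_cong)
    fix z
    have "(\<lambda>n. ennreal ((cmod (S (F (r n)) z - G z))\<^sup>2)) \<longlonglongrightarrow> ennreal ((cmod (0 - G z))\<^sup>2)"
      by (intro tendsto_ennrealI tendsto_intros pt)
    from lim_imp_Liminf[OF sequentially_bot this]
    show "ennreal ((cmod (G z))\<^sup>2) = liminf (\<lambda>n. ennreal ((cmod (S (F (r n)) z - G z))\<^sup>2))" by simp
  qed
  also have "\<dots> \<le> liminf (\<lambda>n. \<integral>\<^sup>+z. ennreal ((cmod (S (F (r n)) z - G z))\<^sup>2) \<partial>lborel)"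
    by (rule nn_integral_liminf) measurable
  also have "\<dots> = liminf (\<lambda>n. ennreal (d n))"
    unfolding d_def using nn_integral_eq_integral[OF bergmanD(3)[OF db]] by simp
  also have "\<dots> = ennreal 0"
    by (intro lim_imp_Liminf tendsto_ennrealI dlim) simp
  finally have "(\<integral>\<^sup>+z. ennreal ((cmod (G z))\<^sup>2) \<partial>lborel) = 0" by simp
  hence "AE z in lborel. G z = 0" by (subst (asm) nn_integral_0_iff_AE) auto
  hence "G = (\<lambda>z. 0)" by (rule bergman_AE_zero[OF G])
  \<comment> \<open>With G = 0, d n is the squared norm of the normalised z^(m r(n)) g, which the
    choice of c bounds below.\<close>
  have "c \<le> d n" for n
  proof -
    have "(c * moment (m * r n)) / moment (m * r n) \<le> (LINT z|lborel. (cmod (z ^ (m * r n) * g z))\<^sup>2) / moment (m * r n)"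
      by (intro divide_right_mono c) (use moment_pos less_imp_le in auto)
    also have "\<dots> = (LINT z|lborel. (cmod (z ^ (m * r n) * g z))\<^sup>2 / moment (m * r n))" by simp
    also have "\<dots> = d n" unfolding d_def SF \<open>G = (\<lambda>z. 0)\<close>
      by (intro Bochner_Integration.integral_cong) (simp_all add: norm_mult power_mult_distrib a2)
    finally show ?thesis using moment_pos[of "m * r n"] by simp
  qed
  hence "c \<le> 0" by (intro LIMSEQ_le_const[OF dlim]) auto
  with c(1) show False by simp
qed

section \<open>Taylor decomposition and removal of the boundedness assumption\<close>

lemma bergman_const: "(\<lambda>z. if z \<in> disk then c else 0) \<in> bergman"
proof (rule bergman_dominated)
  show "(\<lambda>z. if z \<in> disk then c else 0) holomorphic_on disk"
    by (rule holomorphic_transform[of "\<lambda>_. c"]) auto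
  show "integrable lborel (\<lambda>z. (cmod c)\<^sup>2 * indicator disk z)"
    by (intro integrable_mult_right) simp
qed auto

lemma bergman_add:
  assumes "f \<in> bergman" "g \<in> bergman"
  shows "(\<lambda>z. f z + g z) \<in> bergman"
  using bergman_diff[OF assms(1) bergman_cmult[OF assms(2), of "-1"]] by simp

text \<open>The difference quotient at 0 is bounded on the compact disk of radius 1/2, and outside
  it division by z costs at most a factor 2, so square integrability survives.\<close>

lemma bergman_divide_var:
  assumes f: "f \<in> bergman"
  obtains g where "g \<in> bergman" "\<And>z. z \<in> disk \<Longrightarrow> f z = f 0 + z * g z"
proof -
  define q where "q = (\<lambda>z. if z = 0 then deriv f 0 else (f z - f 0) / (z - 0))"
  have q: "q holomorphic_on disk" unfolding q_def
    by (rule pole_lemma_open[OF bergmanD(1)[OF f] open_disk])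
  define g where "g = (\<lambda>z. if z \<in> disk then q z else 0)"
  have "bounded (q ` cball 0 (1/2))"
    by (intro compact_imp_bounded compact_continuous_image holomorphic_on_imp_continuous_on holomorphic_on_subset[OF q])
       (auto simp: disk_def)
  then obtain B where B: "\<And>z. z \<in> cball 0 (1/2) \<Longrightarrow> cmod (q z) \<le> B" by (meson bounded_iff imageI)
  have "g \<in> bergman"
  proof (rule bergman_dominated)
    show "g holomorphic_on disk" by (rule holomorphic_transform[OF q]) (auto simp: g_def)
    show "integrable lborel (\<lambda>z. (B\<^sup>2 + 8 * (cmod (f 0))\<^sup>2) * indicator disk z + 8 * (cmod (f z))\<^sup>2)"
      by (intro Bochner_Integration.integrable_add integrable_mult_right bergmanD(3)[OF f]) simp
    fix z assume z: "z \<in> disk"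
    show "(cmod (g z))\<^sup>2 \<le> (B\<^sup>2 + 8 * (cmod (f 0))\<^sup>2) * indicator disk z + 8 * (cmod (f z))\<^sup>2"
    proof (cases "cmod z \<le> 1/2")
      case True
      hence "(cmod (g z))\<^sup>2 \<le> B\<^sup>2" using B[of z] z by (intro power_mono) (auto simp: g_def)
      also have "\<dots> \<le> (B\<^sup>2 + 8 * (cmod (f 0))\<^sup>2) * indicator disk z + 8 * (cmod (f z))\<^sup>2" using z by simp
      finally show ?thesis .
    next
      case False
      hence "z \<noteq> 0" by auto
      have "cmod (g z) = cmod (f z - f 0) / cmod z"
        using z \<open>z \<noteq> 0\<close> by (simp add: g_def q_def norm_divide)
      also have "\<dots> \<le> cmod (f z - f 0) / (1/2)" using False by (intro divide_left_mono) auto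
      also have "\<dots> \<le> 2 * (cmod (f z) + cmod (f 0))" using norm_triangle_ineq4[of "f z" "f 0"] by simp
      finally have "(cmod (g z))\<^sup>2 \<le> (2 * (cmod (f z) + cmod (f 0)))\<^sup>2" by (intro power_mono) auto
      also have "\<dots> \<le> 8 * (cmod (f 0))\<^sup>2 + 8 * (cmod (f z))\<^sup>2"
        using sum_squares_bound[of "cmod (f z)" "cmod (f 0)"] by (simp add: power2_eq_square algebra_simps)
      also have "\<dots> \<le> (B\<^sup>2 + 8 * (cmod (f 0))\<^sup>2) * indicator disk z + 8 * (cmod (f z))\<^sup>2" using z by simp
      finally show ?thesis .
    qed
  qed (auto simp: g_def)
  moreover have "f z = f 0 + z * g z" if "z \<in> disk" for z using that by (auto simp: g_def q_def)
  ultimately show ?thesis using that by blast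
qed

text \<open>Repeated division by z; p is a Taylor polynomial cut off outside the disk, of which only
  the boundedness is recorded.\<close>

lemma bergman_taylor_decomposition:
  assumes "f \<in> bergman"
  shows "\<exists>p g B. p \<in> bergman \<and> g \<in> bergman \<and> (\<forall>z\<in>disk. cmod (p z) \<le> B) \<and> f = (\<lambda>z. p z + z ^ k * g z)"
proof (induction k)
  case 0
  show ?case
    by (rule exI[of _ "\<lambda>z. 0"], rule exI[of _ f], rule exI[of _ 0])
       (use assms bergman_cmult[OF assms, of 0] in auto)
next
  case (Suc k)
  then obtain p g B where *: "p \<in> bergman" "g \<in> bergman" "\<And>z. z \<in> disk \<Longrightarrow> cmod (p z) \<le> B"
    "f = (\<lambda>z. p z + z ^ k * g z)" by blast
  obtain g' where g': "g' \<in> bergman" "\<And>z. z \<in> disk \<Longrightarrow> g z = g 0 + z * g' z"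
    using bergman_divide_var[OF *(2)] by blast
  define p' where "p' = (\<lambda>z. p z + z ^ k * (if z \<in> disk then g 0 else 0))"
  have "p' \<in> bergman" unfolding p'_def by (intro bergman_add bergman_power_mult bergman_const *)
  moreover have "cmod (p' z) \<le> B + cmod (g 0)" if z: "z \<in> disk" for z
  proof -
    have "cmod (z ^ k * g 0) \<le> 1 * cmod (g 0)"
      unfolding norm_mult using z by (intro mult_right_mono) (auto simp: norm_power in_disk_iff power_le_one)
    thus ?thesis using *(3)[OF z] z norm_triangle_ineq[of "p z" "z ^ k * g 0"] by (simp add: p'_def)
  qed
  moreover have "f = (\<lambda>z. p' z + z ^ Suc k * g' z)"
  proof
    fix z
    show "f z = p' z + z ^ Suc k * g' z"
    proof (cases "z \<in> disk")
      case True
      thus ?thesis unfolding *(4) p'_def using g'(2)[OF True] by (simp add: algebra_simps)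
    next
      case False
      thus ?thesis unfolding *(4) p'_def using bergmanD(2)[OF g'(1) False] bergmanD(2)[OF *(2) False] by simp
    qed
  qed
  ultimately show ?case using g'(1) by blast
qed

text \<open>A nonzero F with F(0) = 0 has a zero of some finite order n there, contradicting
  divisibility by z^(n+1).\<close>

lemma bergman_zero_if_infinite_order:
  assumes F: "F \<in> bergman" and ord: "\<And>k. \<exists>g\<in>bergman. F = (\<lambda>z. z ^ k * g z)"
  shows "F = (\<lambda>z. 0)"
proof (rule ccontr)
  assume ne: "F \<noteq> (\<lambda>z. 0)"
  have d0: "0 \<in> disk" by (simp add: in_disk_iff)
  have F0: "F 0 = 0" using ord[of 1] by auto
  have nc: "\<not> F constant_on disk"
  proof
    assume "F constant_on disk"
    hence "F z = 0" if "z \<in> disk" for z using F0 d0 that by (metis constant_on_def)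
    thus False using ne bergmanD(2)[OF F] by (metis ext)
  qed
  obtain q r n where q: "0 < r" "ball 0 r \<subseteq> disk" "q holomorphic_on ball 0 r"
    "\<And>w. w \<in> ball 0 r \<Longrightarrow> F w = (w - 0) ^ n * q w" "\<And>w. w \<in> ball 0 r \<Longrightarrow> q w \<noteq> 0"
    using holomorphic_factor_zero_nonconstant[OF bergmanD(1)[OF F] open_disk connected_disk d0 F0 nc] by metis
  obtain g where g: "g \<in> bergman" "F = (\<lambda>z. z ^ Suc n * g z)" using ord by blast
  have "continuous_on (ball 0 r) q" "continuous_on (ball 0 r) g"
    using q(2,3) bergmanD(1)[OF g(1)] by (auto intro: holomorphic_on_imp_continuous_on holomorphic_on_subset)
  hence "isCont q 0" "isCont g 0"
    using q(1) by (auto simp: continuous_on_eq_continuous_at)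
  hence "((\<lambda>w. q w - w * g w) \<longlongrightarrow> q 0 - 0 * g 0) (at 0)"
    by (intro tendsto_intros) (auto simp: isCont_def)
  moreover have "\<forall>\<^sub>F w in at 0. q w - w * g w = 0"
    unfolding eventually_at
  proof (intro exI[of _ r] conjI ballI impI q(1))
    fix w :: complex assume w: "w \<noteq> 0 \<and> dist w 0 < r"
    \<comment> \<open>Cancelling w^n off the origin leaves q(w) = w g(w), which forces q(0) = 0 in
      the limit.\<close>
    hence "w ^ n * q w = w ^ Suc n * g w" using q(4)[of w] g(2) by simp
    thus "q w - w * g w = 0" using w by simp
  qed
  hence "((\<lambda>w. q w - w * g w) \<longlongrightarrow> 0) (at 0)" by (rule tendsto_eventually)
  ultimately have "q 0 - 0 * g 0 = 0" by (intro tendsto_unique[of "at (0::complex)"]) auto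
  with q(1) q(5)[of 0] show False by simp
qed

lemma compact_commutant_zero:
  assumes S: "bounded_op S" and comp: "compact_op S" and m: "m > 0"
    and comm: "\<And>f. f \<in> bergman \<Longrightarrow> S (\<lambda>z. z ^ m * f z) = (\<lambda>z. z ^ m * S f z)"
    and f: "f \<in> bergman"
  shows "S f = (\<lambda>z. 0)"
proof (rule bergman_zero_if_infinite_order[OF bounded_opD(1)[OF S f]])
  fix k
  obtain p g B where *: "p \<in> bergman" "g \<in> bergman" "\<And>z. z \<in> disk \<Longrightarrow> cmod (p z) \<le> B"
    "f = (\<lambda>z. p z + z ^ (m * k) * g z)"
    using bergman_taylor_decomposition[OF f] by blast
  have "S p = (\<lambda>z. 0)" by (rule compact_commutant_bounded_zero[OF S comp m comm *(1,3)])
  \<comment> \<open>The bounded part is annihilated, and z^(mk) contains the factor z^k because m >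
    0.\<close>
  hence "S f = (\<lambda>z. z ^ k * (z ^ (m * k - k) * S g z))"
    unfolding *(4) bounded_opD(2)[OF S *(1) bergman_power_mult[OF *(2)]]
    using m iterated_shift[of S m, OF comm *(2), of k] by (simp add: mult.assoc[symmetric] flip: power_add)
  moreover have "(\<lambda>z. z ^ (m * k - k) * S g z) \<in> bergman"
    by (intro bergman_power_mult bounded_opD(1)[OF S] *)
  ultimately show "\<exists>g\<in>bergman. S f = (\<lambda>z. z ^ k * g z)"
    by (intro bexI[of _ "\<lambda>z. z ^ (m * k - k) * S g z"])
qed

section \<open>Conclusion for Toeplitz operators\<close>

theorem theorem0p1:
  fixes m :: nat and h :: "complex poly"
    and S :: "(complex \<Rightarrow> complex) \<Rightarrow> (complex \<Rightarrow> complex)"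
  assumes "m > 0"
    and "\<not> (\<exists>h1 (l::nat). l > 1 \<and> h = pcompose h1 (monom 1 l))"
    and "bounded_op S"
    and "commutes_on_bergman S (toeplitz (\<lambda>z. poly h (z ^ m)))"
  shows "commutes_on_bergman S (toeplitz (\<lambda>z. z ^ m))
         \<and> (compact_op S \<longrightarrow> (\<forall>f\<in>bergman. S f = (\<lambda>z. 0)))"
proof -
  interpret primitive_poly h by standard fact
  note S = \<open>bounded_op S\<close>
  \<comment> \<open>Both symbols are entire, so the Toeplitz operators are plain
    multiplications.\<close>
  have Th: "toeplitz (\<lambda>z. poly h (z ^ m)) f = (\<lambda>z. poly h (z ^ m) * f z)" if "f \<in> bergman" for f
    by (rule toeplitz_entire[OF that]) (intro holomorphic_intros)
  have Tz: "toeplitz (\<lambda>z. z ^ m) f = (\<lambda>z. z ^ m * f z)" if "f \<in> bergman" for f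
    by (rule toeplitz_entire[OF that]) (intro holomorphic_intros)
  have comm: "S (\<lambda>z. z ^ m * f z) = (\<lambda>z. z ^ m * S f z)" if f: "f \<in> bergman" for f
  proof (rule commutant_shift[OF \<open>m > 0\<close> S _ f])
    fix g assume g: "g \<in> bergman"
    show "S (\<lambda>z. poly h (z ^ m) * g z) = (\<lambda>z. poly h (z ^ m) * S g z)"
      using assms(4) g Th[OF g] Th[OF bounded_opD(1)[OF S g]] unfolding commutes_on_bergman_def by metis
  qed
  show ?thesis
  proof (intro conjI impI ballI)
    show "commutes_on_bergman S (toeplitz (\<lambda>z. z ^ m))"
      unfolding commutes_on_bergman_def using comm Tz bounded_opD(1)[OF S] by simp
    show "S f = (\<lambda>z. 0)" if "compact_op S" "f \<in> bergman" for f
      by (rule compact_commutant_zero[OF S that(1) \<open>m > 0\<close> comm that(2)])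
  qed
qed

end
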